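(* Let $f$ be convex-concave in $(x,\xi)$, i.e. $x\mapsto f(x,\xi)$ is convex for each $\xi\in\mathbb{R}^m$ and $\xi\mapsto f(x,\xi)$ is concave for each $x\in\mathbb{R}^d$, and let $\mathcal C=\mathbb{R}^{nd}\times\mathbb{R}^n_{\ge0}$. Assume further that there exists a saddle point $(x_{\mathrm v}^*,\lambda_{\mathrm v}^*,\nu^*,\eta^*,\{(\xi^k)^*\})$ of $\tilde L_{\mathrm{aug}}$ over $\mathcal C\times(\mathbb{R}^n\times\mathbb{R}^{nd}\times\mathbb{R}^{mN})$ satisfying $\lambda_{\mathrm v}^*>\mathbf 0_n$. Then the trajectories of the saddle-point dynamics (SP) stated in the context starting in $\mathcal C\times\mathbb{R}^n\times\mathbb{R}^{nd}\times\mathbb{R}^{mN}$ remain in this set and converge asymptotically (as $t\to\infty$) to a saddle point of $\tilde L_{\mathrm{aug}}$ over $\mathcal C\times(\mathbb{R}^n\times\mathbb{R}^{nd}\times\mathbb{R}^{mN})$. As a consequence, the $(x_{\mathrm v},\lambda_{\mathrm v})$ component of the trajectory converges to an optimizer of problem (D) stated in the context.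
   Context: $n,N,d,m$ are positive integers and $\epsilon\ge 0$. $\mathcal G$ is a connected undirected weighted graph on the vertex set $\{1,\dots,n\}$ (the agents) with symmetric adjacency matrix $\mathsf A=(a_{ij})$, $a_{ij}>0$ if $(i,j)$ is an edge and $a_{ij}=0$ otherwise; $\mathsf L=\mathsf D-\mathsf A$ is its Laplacian, where $\mathsf D$ is the diagonal matrix with entries $\sum_j a_{ij}$. The samples $\hat\xi^{\,1},\dots,\hat\xi^{\,N}\in\mathbb{R}^m$ are distributed among the agents: each sample is held by exactly one agent and each agent holds at least one; $v_k\in\{1,\dots,n\}$ is the agent holding $\hat\xi^{\,k}$. The function $f:\mathbb{R}^d\times\mathbb{R}^m\to\mathbb{R}$ is continuously differentiable, and the set of $\xi\in\mathbb{R}^m$ for which neither $\mathbf 1_d$ nor $-\mathbf 1_d$ is a direction of recession of $x\mapsto f(x,\xi)$ is dense in $\mathbb{R}^m$ (a vector $w$ is a direction of recession of a finite convex function $\phi$ if $\phi(x+\alpha w)\le\phi(x)$ for all $x$ and $\alpha\ge0$). Notation: $h(\lambda_{\mathrm v}):=\epsilon^2(\mathbf 1_n^\top\lambda_{\mathrm v})/n$; $g_k(x,\lambda,\xi):=f(x,\xi)-\lambda\|\xi-\hat\xi^{\,k}\|^2$; $x_{\mathrm v}=(x^1;\dots;x^n)$ with $x^i\in\mathbb{R}^d$; $\lambda_{\mathrm v}=(\lambda^1;\dots;\lambda^n)$ with $\lambda^i\in\mathbb{R}$; $\nu\in\mathbb{R}^n$; $\eta\in\mathbb{R}^{nd}$;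 $\{\xi^k\}=(\xi^1,\dots,\xi^N)$ with $\xi^k\in\mathbb{R}^m$; $$F(x_{\mathrm v},\lambda_{\mathrm v}):=h(\lambda_{\mathrm v})+\frac1N\sum_{k=1}^N\max_{\xi\in\mathbb{R}^m}g_k(x^{v_k},\lambda^{v_k},\xi)\in(-\infty,+\infty],$$ $$\tilde L_{\mathrm{aug}}(x_{\mathrm v},\lambda_{\mathrm v},\nu,\eta,\{\xi^k\}):=h(\lambda_{\mathrm v})+\frac1N\sum_{k=1}^Ng_k(x^{v_k},\lambda^{v_k},\xi^k)+\nu^\top\mathsf L\lambda_{\mathrm v}+\eta^\top(\mathsf L\otimes\mathsf I_d)x_{\mathrm v}+\tfrac12x_{\mathrm v}^\top(\mathsf L\otimes\mathsf I_d)x_{\mathrm v}+\tfrac12\lambda_{\mathrm v}^\top\mathsf L\lambda_{\mathrm v}.$$ $\mathbf 1_n,\mathbf 0_n$ are the all-ones and zero vectors, $\mathsf I_d$ the identity, $\otimes$ the Kronecker product; vector inequalities are componentwise. Problem (D): minimize $F(x_{\mathrm v},\lambda_{\mathrm v})$ over $x_{\mathrm v}\in\mathbb{R}^{nd}$, $\lambda_{\mathrm v}\ge\mathbf 0_n$ subject to $\mathsf L\lambda_{\mathrm v}=\mathbf 0_n$ and $(\mathsf L\otimes\mathsf I_d)x_{\mathrm v}=\mathbf 0_{nd}$. Standing assumption: for problem (P), $\inf_{\lambda\ge0,\,x\in\mathbb{R}^d}\{\lambda\epsilon^2+\frac1N\sum_{k=1}^N\max_{\xi\in\mathbb{R}^m}g_k(x,\lambda,\xi)\}$,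 the set of $(\lambda,x)\in\mathbb{R}_{\ge0}\times\mathbb{R}^d$ at which the objective is finite has nonempty interior, and there exists a finite optimizer $(x^*,\lambda^* )$. A point $(p_*,q_* )\in\mathcal P\times\mathcal Q$ is a saddle point of $\Phi$ over $\mathcal P\times\mathcal Q$ if $\Phi(p_*,q)\le\Phi(p_*,q_* )\le\Phi(p,q_* )$ for all $p\in\mathcal P$, $q\in\mathcal Q$. For a closed convex set $\mathcal K$, $y\in\mathcal K$ and a vector $w$, $\Pi_{\mathcal K}(y,w):=\lim_{\delta\to0^+}\frac{\mathrm{proj}_{\mathcal K}(y+\delta w)-y}{\delta}$, where $\mathrm{proj}_{\mathcal K}$ is the Euclidean projection onto $\mathcal K$. The saddle-point dynamics (SP) is, with all gradients of $\tilde L_{\mathrm{aug}}$ evaluated at $(x_{\mathrm v},\lambda_{\mathrm v},\nu,\eta,\{\xi^k\})$, $$\frac{d}{dt}\begin{bmatrix}x_{\mathrm v}\\ \lambda_{\mathrm v}\end{bmatrix}=\Pi_{\mathcal C}\Bigl((x_{\mathrm v},\lambda_{\mathrm v}),\begin{bmatrix}-\nabla_{x_{\mathrm v}}\tilde L_{\mathrm{aug}}\\-\nabla_{\lambda_{\mathrm v}}\tilde L_{\mathrm{aug}}\end{bmatrix}\Bigr),\quad \frac{d\nu}{dt}=\nabla_\nu\tilde L_{\mathrm{aug}},\quad\frac{d\eta}{dt}=\nabla_\eta\tilde L_{\mathrm{aug}},\quad\frac{d\xi^k}{dt}=\nabla_{\xi^k}\tilde L_{\mathrm{aug}}\;\;(k=1,\dots,N).$$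 Trajectories are Caratheodory solutions: absolutely continuous curves satisfying the equations for almost every time. *)

theory Defs
  imports "HOL-Analysis.Analysis"
begin

definition gradient :: "('a::real_inner \<Rightarrow> real) \<Rightarrow> 'a \<Rightarrow> 'a"
  where "gradient \<phi> z = (THE D. GDERIV \<phi> z :> D)"

definition continuously_differentiable :: "('a::real_inner \<Rightarrow> real) \<Rightarrow> bool"
  where "continuously_differentiable \<phi> \<longleftrightarrow>
    (\<exists>G. (\<forall>z. GDERIV \<phi> z :> G z) \<and> continuous_on UNIV G)"

definition recession_direction :: "('a::real_vector \<Rightarrow> real) \<Rightarrow> 'a \<Rightarrow> bool"
  where "recession_direction \<phi> w \<longleftrightarrow> (\<forall>x. \<forall>\<alpha>\<ge>0. \<phi> (x + \<alpha> *\<^sub>R w) \<le> \<phi> x)"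

definition saddle_point_over ::
  "('p \<Rightarrow> 'q \<Rightarrow> real) \<Rightarrow> 'p set \<Rightarrow> 'q set \<Rightarrow> 'p \<times> 'q \<Rightarrow> bool"
  where "saddle_point_over \<Phi> P Q s \<longleftrightarrow> fst s \<in> P \<and> snd s \<in> Q \<and>
    (\<forall>p\<in>P. \<forall>q\<in>Q. \<Phi> (fst s) q \<le> \<Phi> (fst s) (snd s) \<and> \<Phi> (fst s) (snd s) \<le> \<Phi> p (snd s))"

text \<open>
  The operator \<open>\<Pi>\<^sub>K(y, w)\<close> as a relation: \<open>v\<close> is its value iff the limit of the difference
  quotients exists and equals \<open>v\<close>.  For closed \<open>K\<close> the quotients diverge when \<open>y \<notin> K\<close>, so no
  value is assigned there.
\<close>

definition has_projected_value ::
  "'a::euclidean_space set \<Rightarrow> 'a \<Rightarrow> 'a \<Rightarrow> 'a \<Rightarrow> bool"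
  where "has_projected_value K y w v \<longleftrightarrow>
    ((\<lambda>\<delta>. (closest_point K (y + \<delta> *\<^sub>R w) - y) /\<^sub>R \<delta>) \<longlongrightarrow> v) (at_right 0)"

text \<open>
  A division \<open>D\<close> of a subset of \<open>[a, b]\<close> is a finite set of
  non-overlapping closed intervals \<open>[Inf I, Sup I]\<close>.
\<close>

definition abs_continuous_on ::
  "real \<Rightarrow> real \<Rightarrow> (real \<Rightarrow> 'a::real_normed_vector) \<Rightarrow> bool"
  where "abs_continuous_on a b \<gamma> \<longleftrightarrow> (\<forall>e>0. \<exists>\<delta>>0. \<forall>D S.
    D division_of S \<and> S \<subseteq> {a..b} \<and> (\<Sum>I\<in>D. Sup I - Inf I) < \<delta> \<longrightarrow>
    (\<Sum>I\<in>D. norm (\<gamma> (Sup I) - \<gamma> (Inf I))) < e)"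

text \<open>
  A solution on \<open>[0, \<infinity>)\<close> of \<open>dy/dt = R(y)\<close>, where \<open>R y v\<close> says that the (single-valued,
  possibly partial) right-hand side takes the value \<open>v\<close> at \<open>y\<close>.
\<close>

definition caratheodory_solution ::
  "('a::real_normed_vector \<Rightarrow> 'a \<Rightarrow> bool) \<Rightarrow> (real \<Rightarrow> 'a) \<Rightarrow> bool"
  where "caratheodory_solution R \<gamma> \<longleftrightarrow> (\<forall>T>0. abs_continuous_on 0 T \<gamma>) \<and>
    (AE t in lebesgue. 0 < t \<longrightarrow> (\<exists>v. (\<gamma> has_vector_derivative v) (at t) \<and> R (\<gamma> t) v))"

definition connected_weighted_graph :: "('n \<times> 'n) set \<Rightarrow> real^'n^'n \<Rightarrow> bool"
  where "connected_weighted_graph E A \<longleftrightarrow>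
    sym E \<and> (\<forall>i j. (i, j) \<in> E\<^sup>*) \<and> transpose A = A \<and>
    (\<forall>i j. if (i, j) \<in> E then 0 < A $ i $ j else A $ i $ j = 0)"

definition laplacian :: "real^'n^'n \<Rightarrow> real^'n^'n"
  where "laplacian A = (\<chi> i j. if i = j then (\<Sum>k\<in>UNIV. A $ i $ k) else 0) - A"

definition kronecker_product ::
  "real^'b^'a \<Rightarrow> real^'d^'c \<Rightarrow> real^('b \<times> 'd)^('a \<times> 'c)" (infixl \<open>\<otimes>\<^sub>K\<close> 70)
  where "A \<otimes>\<^sub>K B = (\<chi> p q. A $ fst p $ fst q * B $ snd p $ snd q)"

text \<open>
  Agents are indexed by \<open>'n\<close>, samples by \<open>'N\<close>.  The stacked space \<open>\<real>\<^sup>n\<^sup>d\<close> is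
  \<open>real^('n \<times> 'd)\<close>, whose \<open>i\<close>-th block is \<open>block x i\<close>.
\<close>

definition block :: "real^('n::finite \<times> 'd::finite) \<Rightarrow> 'n \<Rightarrow> real^'d"
  where "block x i = (\<chi> a. x $ (i, a))"

definition g_fun ::
  "(real^'d \<Rightarrow> real^'m \<Rightarrow> real) \<Rightarrow> ('N \<Rightarrow> real^'m) \<Rightarrow> 'N \<Rightarrow> real^'d \<Rightarrow> real \<Rightarrow> real^'m \<Rightarrow> real"
  where "g_fun f \<xi>hat k x l \<xi> = f x \<xi> - l * (norm (\<xi> - \<xi>hat k))\<^sup>2"

definition h_fun :: "real \<Rightarrow> real^'n \<Rightarrow> real"
  where "h_fun \<epsilon> l = \<epsilon>\<^sup>2 * (1 \<bullet> l) / real CARD('n)"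

text \<open>The maximum over \<open>\<xi>\<close> may be infinite, hence the supremum in the extended reals.\<close>

definition P_objective ::
  "(real^'d \<Rightarrow> real^'m \<Rightarrow> real) \<Rightarrow> real \<Rightarrow> ('N::finite \<Rightarrow> real^'m) \<Rightarrow> real \<Rightarrow> real^'d \<Rightarrow> ereal"
  where "P_objective f \<epsilon> \<xi>hat l x = ereal (l * \<epsilon>\<^sup>2) +
    ereal (1 / real CARD('N)) * (\<Sum>k\<in>UNIV. SUP \<xi>. ereal (g_fun f \<xi>hat k x l \<xi>))"

definition F_objective ::
  "(real^'d \<Rightarrow> real^'m \<Rightarrow> real) \<Rightarrow> real \<Rightarrow> ('N::finite \<Rightarrow> 'n) \<Rightarrow> ('N \<Rightarrow> real^'m) \<Rightarrow>
   real^('n::finite \<times> 'd::finite) \<Rightarrow> real^'n \<Rightarrow> ereal"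
  where "F_objective f \<epsilon> v \<xi>hat x l = ereal (h_fun \<epsilon> l) +
    ereal (1 / real CARD('N)) *
      (\<Sum>k\<in>UNIV. SUP \<xi>. ereal (g_fun f \<xi>hat k (block x (v k)) (l $ v k) \<xi>))"

definition D_feasible :: "real^'n^'n \<Rightarrow> ((real^('n::finite \<times> 'd::finite)) \<times> (real^'n)) set"
  where "D_feasible L = {(x, l). (\<forall>i. 0 \<le> l $ i) \<and> L *v l = 0 \<and>
    (L \<otimes>\<^sub>K (mat 1 :: real^'d^'d)) *v x = 0}"

definition D_optimizer ::
  "(real^'d \<Rightarrow> real^'m \<Rightarrow> real) \<Rightarrow> real \<Rightarrow> real^'n^'n \<Rightarrow> ('N::finite \<Rightarrow> 'n) \<Rightarrow>
   ('N \<Rightarrow> real^'m) \<Rightarrow> (real^('n::finite \<times> 'd::finite)) \<times> (real^'n) \<Rightarrow> bool"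
  where "D_optimizer f \<epsilon> L v \<xi>hat p \<longleftrightarrow> p \<in> D_feasible L \<and>
    (\<forall>p'\<in>D_feasible L.
      F_objective f \<epsilon> v \<xi>hat (fst p) (snd p) \<le> F_objective f \<epsilon> v \<xi>hat (fst p') (snd p'))"

definition L_aug ::
  "(real^'d \<Rightarrow> real^'m \<Rightarrow> real) \<Rightarrow> real \<Rightarrow> real^'n^'n \<Rightarrow> ('N::finite \<Rightarrow> 'n) \<Rightarrow> ('N \<Rightarrow> real^'m) \<Rightarrow>
   real^('n::finite \<times> 'd::finite) \<Rightarrow> real^'n \<Rightarrow> real^'n \<Rightarrow> real^('n \<times> 'd) \<Rightarrow> real^'m^'N \<Rightarrow> real"
  where "L_aug f \<epsilon> L v \<xi>hat x l \<nu> \<eta> \<xi> =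
    h_fun \<epsilon> l
    + 1 / real CARD('N) * (\<Sum>k\<in>UNIV. g_fun f \<xi>hat k (block x (v k)) (l $ v k) (\<xi> $ k))
    + \<nu> \<bullet> (L *v l) + \<eta> \<bullet> ((L \<otimes>\<^sub>K (mat 1 :: real^'d^'d)) *v x)
    + 1 / 2 * (x \<bullet> ((L \<otimes>\<^sub>K (mat 1 :: real^'d^'d)) *v x)) + 1 / 2 * (l \<bullet> (L *v l))"

definition C_set :: "((real^('n::finite \<times> 'd::finite)) \<times> (real^'n)) set"
  where "C_set = UNIV \<times> {l. \<forall>i. 0 \<le> l $ i}"

type_synonym ('n, 'd, 'm, 'N) sp_state =
  "((real^('n \<times> 'd)) \<times> (real^'n)) \<times> ((real^'n) \<times> (real^('n \<times> 'd)) \<times> (real^'m^'N))"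

definition L_aug_saddle_point ::
  "(real^'d \<Rightarrow> real^'m \<Rightarrow> real) \<Rightarrow> real \<Rightarrow> real^'n^'n \<Rightarrow> ('N::finite \<Rightarrow> 'n) \<Rightarrow> ('N \<Rightarrow> real^'m) \<Rightarrow>
   ('n::finite, 'd, 'm, 'N) sp_state \<Rightarrow> bool"
  where "L_aug_saddle_point f \<epsilon> L v \<xi>hat s \<longleftrightarrow>
    saddle_point_over (\<lambda>(x, l) (\<nu>, \<eta>, \<xi>). L_aug f \<epsilon> L v \<xi>hat x l \<nu> \<eta> \<xi>) C_set UNIV s"

fun sp_field ::
  "(real^'d \<Rightarrow> real^'m \<Rightarrow> real) \<Rightarrow> real \<Rightarrow> real^'n^'n \<Rightarrow> ('N::finite \<Rightarrow> 'n) \<Rightarrow> ('N \<Rightarrow> real^'m) \<Rightarrow>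
   ('n, 'd, 'm, 'N) sp_state \<Rightarrow> ('n::finite, 'd, 'm, 'N) sp_state \<Rightarrow> bool"
  where "sp_field f \<epsilon> L v \<xi>hat ((x, l), (\<nu>, \<eta>, \<xi>)) (dp, (d\<nu>, d\<eta>, d\<xi>)) \<longleftrightarrow>
    has_projected_value C_set (x, l)
      (- gradient (\<lambda>x'. L_aug f \<epsilon> L v \<xi>hat x' l \<nu> \<eta> \<xi>) x,
       - gradient (\<lambda>l'. L_aug f \<epsilon> L v \<xi>hat x l' \<nu> \<eta> \<xi>) l) dp \<and>
    d\<nu> = gradient (\<lambda>\<nu>'. L_aug f \<epsilon> L v \<xi>hat x l \<nu>' \<eta> \<xi>) \<nu> \<and>
    d\<eta> = gradient (\<lambda>\<eta>'. L_aug f \<epsilon> L v \<xi>hat x l \<nu> \<eta>' \<xi>) \<eta> \<and>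
    (\<forall>k. d\<xi> $ k = gradient (\<lambda>z. L_aug f \<epsilon> L v \<xi>hat x l \<nu> \<eta> (\<chi> j. if j = k then z else \<xi> $ j)) (\<xi> $ k))"

end

(*
  Along a solution y = (p, q) of a saddle flow, convexity-concavity and the obtuse angle property of
  the projection give d/dt |y - w|^2 / 2 <= Phi(p_w, q) - Phi(p, q_w) for every fixed w = (p_w, q_w)
  in the constraint set; this inequality alone drives the proof.  With w a saddle point the distance
  to w decreases, so the trajectory is bounded and the dissipation vanishes at its limit points.
  There p is in consensus (the quadratic augmentation) and xi = xi^* (lambda^* > 0), hence a limit
  point z neither gains nor loses energy relative to another one, and the trajectory lingers near z
  for unit time.  The inequality over that time, for arbitrary w, says that z is itself a saddle
  point, so the distance to z decreases to 0.
*)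
theory Submission
  imports Defs
begin

text \<open>A projected field is discontinuous and a Caratheodory solution is differentiable only
  almost everywhere, so a LaSalle argument through invariance of the limit set under the flow does
  not apply directly. The integrated energy inequality replaces it; absolute continuity carries a
  bound on the derivative almost everywhere over to increments. Vanishing dissipation alone would
  not suffice: for a bilinear saddle function the dissipation is zero everywhere and trajectories
  can circle the saddle point at constant distance. Consensus excludes this. At a primal point in
  consensus all Laplacian terms of \<open>L_aug\<close> vanish, so its value there does not depend
  on \<open>\<nu>\<close> and \<open>\<eta>\<close>. Once \<open>\<xi>\<close> is fixed too, the
  primal part of one point of zero dissipation evaluated against the dual part of another always
  gives the saddle value.\<close>

section \<open>Absolutely continuous functions\<close>

text \<open>Distinct members of a division meet in a convex set without interior, hence in a null
  set, so their lengths add up to the measure of the union.\<close>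

lemma sum_content_partial_division_le:
  fixes D :: "real set set"
  assumes D: "D division_of \<Union>D" and U: "\<Union>D \<subseteq> U" "U \<in> lmeasurable"
  shows "(\<Sum>K\<in>D. Sup K - Inf K) \<le> measure lebesgue U"
proof -
  have interval: "\<exists>a b. K = {a..b} \<and> a \<le> b" if "K \<in> D" for K
    using division_ofD(3,4)[OF D that] by fastforce
  have meas: "K \<in> lmeasurable \<and> measure lebesgue K = Sup K - Inf K" if "K \<in> D" for K
    using interval[OF that] by auto
  have "pairwise (\<lambda>S T. negligible (S \<inter> T)) D"
  proof (rule pairwiseI)
    fix S T assume ST: "S \<in> D" "T \<in> D" "S \<noteq> T"
    have "interior (S \<inter> T) = {}"
      using division_ofD(5)[OF D ST(1,2)] ST(3) by simp
    moreover have "convex (S \<inter> T)"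
      using interval ST by (metis convex_Int convex_closed_interval convex_real_interval(5))
    ultimately show "negligible (S \<inter> T)"
      by (simp add: negligible_convex_interior)
  qed
  then have "measure lebesgue (\<Union>D) = (\<Sum>K\<in>D. measure lebesgue K)"
    using division_ofD(1)[OF D] meas by (intro measure_negligible_finite_Union) auto
  moreover have "measure lebesgue (\<Union>D) \<le> measure lebesgue U"
    using U meas division_ofD(1)[OF D] by (intro measure_mono_fmeasurable) (auto intro!: fmeasurableD sets.finite_Union)
  ultimately show ?thesis
    using meas by simp
qed

lemma abs_continuous_on_subset:
  assumes "abs_continuous_on a b \<gamma>" "a \<le> c" "d \<le> b"
  shows "abs_continuous_on c d \<gamma>"
  unfolding abs_continuous_on_def
proof (intro allI impI)
  fix e :: real assume "e > 0"
  then obtain \<delta> where \<delta>: "\<delta> > 0"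
    "\<And>D S. D division_of S \<Longrightarrow> S \<subseteq> {a..b} \<Longrightarrow> (\<Sum>I\<in>D. Sup I - Inf I) < \<delta> \<Longrightarrow>
      (\<Sum>I\<in>D. norm (\<gamma> (Sup I) - \<gamma> (Inf I))) < e"
    using assms(1) unfolding abs_continuous_on_def by metis
  have "{c..d} \<subseteq> {a..b}" using assms(2,3) by auto
  then show "\<exists>\<delta>>0. \<forall>D S. D division_of S \<and> S \<subseteq> {c..d} \<and> (\<Sum>I\<in>D. Sup I - Inf I) < \<delta> \<longrightarrow>
      (\<Sum>I\<in>D. norm (\<gamma> (Sup I) - \<gamma> (Inf I))) < e"
    using \<delta> by (intro exI[of _ \<delta>]) (meson order_trans)
qed

lemma abs_continuous_on_imp_continuous_on:
  assumes "abs_continuous_on a b \<gamma>"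
  shows "continuous_on {a..b} \<gamma>"
  unfolding continuous_on_iff
proof (intro ballI allI impI)
  fix x and e :: real assume x: "x \<in> {a..b}" and "e > 0"
  then obtain \<delta> where \<delta>: "\<delta> > 0"
    "\<And>D S. D division_of S \<Longrightarrow> S \<subseteq> {a..b} \<Longrightarrow> (\<Sum>I\<in>D. Sup I - Inf I) < \<delta> \<Longrightarrow>
      (\<Sum>I\<in>D. norm (\<gamma> (Sup I) - \<gamma> (Inf I))) < e"
    using assms unfolding abs_continuous_on_def by metis
  have *: "norm (\<gamma> z - \<gamma> y) < e" if "y \<in> {a..b}" "z \<in> {a..b}" "y \<le> z" "z - y < \<delta>" for y z
    using \<delta>(2)[of "{{y..z}}" "{y..z}"] that division_of_self[of y z] by simp
  have "dist (\<gamma> x') (\<gamma> x) < e" if "x' \<in> {a..b}" "dist x' x < \<delta>" for x'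
    using *[of x x'] *[of x' x] that x
    by (cases "x \<le> x'") (auto simp: dist_norm norm_minus_commute)
  then show "\<exists>d>0. \<forall>x'\<in>{a..b}. dist x' x < d \<longrightarrow> dist (\<gamma> x') (\<gamma> x) < e"
    using \<delta>(1) by blast
qed

text \<open>
  Straddled points of differentiability contribute at most slope \<open>K + e\<close>; the intervals tagged in
  the exceptional null set have small total length, so absolute continuity makes them harmless.
\<close>

lemma abs_continuous_on_increment_le:
  fixes \<phi> :: "real \<Rightarrow> real"
  assumes ac: "abs_continuous_on a b \<phi>" and "a \<le> b"
    and ae: "AE t in lebesgue. a < t \<and> t < b \<longrightarrow> (\<exists>d\<le>K. (\<phi> has_real_derivative d) (at t))"
  shows "\<phi> b - \<phi> a \<le> K * (b - a)"
proof -
  obtain N0 where N0: "\<And>t. t \<notin> N0 \<Longrightarrow> a < t \<and> t < b \<longrightarrow> (\<exists>d\<le>K. (\<phi> has_real_derivative d) (at t))"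
    and "N0 \<in> null_sets lebesgue"
    using AE_E3[OF ae] by (auto simp del: split_paired_Ex)
  \<comment> \<open>The endpoints join the exceptional set because \<open>ae\<close> speaks only
    about the open interval.\<close>
  define N where "N = N0 \<union> {a, b}"
  have negN: "negligible N"
    using \<open>N0 \<in> null_sets lebesgue\<close> unfolding N_def by (simp add: negligible_iff_null_sets[symmetric])
  have approx: "\<phi> b - \<phi> a \<le> (K + e) * (b - a) + 2 * e" if "e > 0" for e
  proof -
    obtain \<delta> where \<delta>: "\<delta> > 0"
      "\<And>D S. D division_of S \<Longrightarrow> S \<subseteq> {a..b} \<Longrightarrow> (\<Sum>I\<in>D. Sup I - Inf I) < \<delta> \<Longrightarrow>
        (\<Sum>I\<in>D. norm (\<phi> (Sup I) - \<phi> (Inf I))) < e"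
      using ac \<open>e > 0\<close> unfolding abs_continuous_on_def by metis
    \<comment> \<open>The first bound lets absolute continuity keep the increments over exceptional
      intervals below \<open>e\<close> in total; the second pays for their lengths, charged at rate
      |K| + e.\<close>
    define \<epsilon> where "\<epsilon> = min \<delta> (e / (\<bar>K\<bar> + e + 1))"
    have \<epsilon>: "\<epsilon> > 0" "\<epsilon> \<le> \<delta>" using \<delta>(1) \<open>e > 0\<close> by (auto simp: \<epsilon>_def)
    have "(\<bar>K\<bar> + e) * \<epsilon> \<le> (\<bar>K\<bar> + e) * (e / (\<bar>K\<bar> + e + 1))"
      using \<open>e > 0\<close> by (intro mult_left_mono) (auto simp: \<epsilon>_def)
    also have "\<dots> \<le> e" using \<open>e > 0\<close> by (simp add: field_simps)
    finally have K\<epsilon>: "(\<bar>K\<bar> + e) * \<epsilon> \<le> e" .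
    obtain U where U: "open U" "N \<subseteq> U" "U - N \<in> lmeasurable" "emeasure lebesgue (U - N) < ennreal \<epsilon>"
      using sets_lebesgue_outer_open[OF negligible_imp_sets[OF negN] \<epsilon>(1)] by blast
    have Ueq: "U = (U - N) \<union> N" using U(2) by auto
    have Um: "U \<in> lmeasurable"
      by (subst Ueq) (intro fmeasurable.Un U(3) negligible_imp_measurable[OF negN])
    have "measure lebesgue U = measure lebesgue (U - N)"
      using measure_Diff_null_set[of U lebesgue N] negN Um
      by (simp add: negligible_iff_null_sets fmeasurableD)
    also have "\<dots> < \<epsilon>"
      using U(3,4) \<epsilon>(1) by (simp add: emeasure_eq_measure2 ennreal_less_iff)
    finally have Ume: "measure lebesgue U < \<epsilon>" .
    \<comment> \<open>A gauge: at an exceptional tag the ball stays in the small open set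
      \<open>U\<close>, at any other tag in \<open>{a..b}\<close> the derivative estimate holds on
      the whole ball.\<close>
    have "\<exists>r>0. (t \<in> N \<longrightarrow> ball t r \<subseteq> U) \<and> (t \<notin> N \<longrightarrow> t \<in> {a..b} \<longrightarrow>
        (\<forall>y\<in>ball t r. \<exists>d\<le>K. \<bar>\<phi> y - \<phi> t - d * (y - t)\<bar> \<le> e * \<bar>y - t\<bar>))" for t
    proof (cases "t \<in> N")
      case True
      then show ?thesis using U(1,2) open_contains_ball by blast
    next
      case tN: False
      show ?thesis
      proof (cases "t \<in> {a..b}")
        case True
        then obtain d where d: "d \<le> K" "(\<phi> has_real_derivative d) (at t)"
          using N0[of t] tN unfolding N_def by fastforce
        then obtain r where "r > 0" "\<And>y. norm (y - t) < r \<Longrightarrow> norm (\<phi> y - \<phi> t - d * (y - t)) \<le> e * norm (y - t)"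
          using \<open>e > 0\<close> unfolding has_field_derivative_def has_derivative_at_alt by blast
        then show ?thesis using tN d(1)
          by (intro exI[of _ r]) (auto simp: dist_real_def abs_minus_commute)
      qed (use tN in \<open>auto intro: exI[of _ 1]\<close>)
    qed
    then obtain r where r: "\<And>t. r t > 0" "\<And>t. t \<in> N \<Longrightarrow> ball t (r t) \<subseteq> U"
      "\<And>t y. t \<notin> N \<Longrightarrow> t \<in> {a..b} \<Longrightarrow> y \<in> ball t (r t) \<Longrightarrow> \<exists>d\<le>K. \<bar>\<phi> y - \<phi> t - d * (y - t)\<bar> \<le> e * \<bar>y - t\<bar>"
      by metis
    have "gauge (\<lambda>t. ball t (r t))" using r(1) by (simp add: gauge_def)
    then obtain p where p: "p tagged_division_of {a..b}" "(\<lambda>t. ball t (r t)) fine p"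
      by (rule fine_division_exists_real)
    note pD = tagged_division_ofD[OF p(1)]
    define q where "q = {xk \<in> p. fst xk \<in> N}"
    have finp: "finite p" "finite q" using pD(1) by (auto simp: q_def)
    have qpart: "q tagged_partial_division_of {a..b}"
      using p(1) tagged_partial_division_subset[of p "{a..b}" q]
      by (auto simp: tagged_division_of_def q_def)
    let ?D = "snd ` q"
    have D: "?D division_of \<Union>?D" by (rule partial_division_of_tagged_division[OF qpart])
    have DU: "\<Union>?D \<subseteq> U"
      using p(2) r(2) unfolding fine_def q_def by fastforce
    have Dab: "\<Union>?D \<subseteq> {a..b}" using pD(3) unfolding q_def by fastforce
    \<comment> \<open>Two tags can share an interval only if it is a single point, where
      \<open>F\<close> vanishes.\<close>
    have reindex: "(\<Sum>xk\<in>q. F (snd xk)) = sum F ?D"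
      if F0: "\<And>u. F {u} = 0" for F :: "real set \<Rightarrow> real"
    proof -
      have "sum F (snd ` q) = sum (F \<circ> snd) q"
      proof (rule sum.reindex_nontrivial[OF finp(2)])
        fix x y assume xy: "x \<in> q" "y \<in> q" "x \<noteq> y" "snd x = snd y"
        define k where "k = snd x"
        have x: "(fst x, k) \<in> p"
          using xy(1) by (simp add: k_def q_def)
        have y: "(fst y, k) \<in> p"
          using xy(2) by (simp add: k_def q_def xy(4))
        have ne: "(fst x, k) \<noteq> (fst y, k)"
          using xy(3,4) by (simp add: prod_eq_iff k_def)
        have int: "interior k = {}"
          using pD(5)[OF x y ne] by simp
        obtain u w where uw: "k = {u..w}"
          using pD(4)[OF x] by auto
        have "u = w"
          using int pD(2)[OF x] by (auto simp: uw)
        then show "F (snd x) = 0"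
          using F0 uw by (simp add: k_def)
      qed
      then show ?thesis by simp
    qed
    let ?len = "\<lambda>k::real set. Sup k - Inf k" and ?inc = "\<lambda>k. \<phi> (Sup k) - \<phi> (Inf k)"
    have lenD: "sum ?len ?D < \<epsilon>"
      using sum_content_partial_division_le[OF D DU Um] Ume by simp
    have incD: "(\<Sum>k\<in>?D. \<bar>?inc k\<bar>) < e"
      using \<delta>(2)[OF D Dab] lenD \<epsilon>(2) by simp
    have lenq: "(\<Sum>xk\<in>q. ?len (snd xk)) < \<epsilon>"
      and incq: "(\<Sum>xk\<in>q. \<bar>?inc (snd xk)\<bar>) < e"
      using lenD incD reindex[of ?len] reindex[of "\<lambda>k. \<bar>?inc k\<bar>"] by simp_all
    have good: "?inc k \<le> (K + e) * ?len k" if tk: "(t, k) \<in> p" "t \<notin> N" for t k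
    proof -
      obtain u w where k: "k = {u..w}" using pD(4)[OF tk(1)] by auto
      have t: "u \<le> t" "t \<le> w" "t \<in> {a..b}" using pD(2,3)[OF tk(1)] k by auto
      have "k \<subseteq> ball t (r t)" using p(2) tk(1) unfolding fine_def by auto
      moreover have "u \<in> k" "w \<in> k" using k t by auto
      ultimately have "u \<in> ball t (r t)" "w \<in> ball t (r t)" by (auto simp del: mem_ball)
      then obtain d d' where
        d: "d \<le> K" "\<bar>\<phi> u - \<phi> t - d * (u - t)\<bar> \<le> e * \<bar>u - t\<bar>" and
        d': "d' \<le> K" "\<bar>\<phi> w - \<phi> t - d' * (w - t)\<bar> \<le> e * \<bar>w - t\<bar>"
        using r(3)[OF tk(2) t(3)] by meson
      have "d * (t - u) \<le> K * (t - u)" "d' * (w - t) \<le> K * (w - t)"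
        using d(1) d'(1) t by (auto intro: mult_right_mono)
      moreover have "\<phi> t - \<phi> u \<le> d * (t - u) + e * (t - u)"
        using d(2) t by (auto simp: abs_le_iff algebra_simps)
      moreover have "\<phi> w - \<phi> t \<le> d' * (w - t) + e * (w - t)"
        using d'(2) t by (auto simp: abs_le_iff algebra_simps)
      ultimately have "\<phi> w - \<phi> u \<le> (K + e) * (w - u)" by (simp add: algebra_simps)
      then show ?thesis using k t by simp
    qed
    \<comment> \<open>A correction that allows every interval of \<open>p\<close> to be charged at
      slope \<open>K + e\<close>: on an exceptional interval it dominates the increment and offsets
      a possibly negative \<open>K + e\<close>.\<close>
    let ?extra = "\<lambda>xk. \<bar>?inc (snd xk)\<bar> + (\<bar>K\<bar> + e) * ?len (snd xk)"
    have each: "?inc (snd xk) \<le> (K + e) * ?len (snd xk) + (if xk \<in> q then ?extra xk else 0)"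
      if xk: "xk \<in> p" for xk
    proof -
      obtain t k where tk: "xk = (t, k)" "(t, k) \<in> p" using xk by (cases xk) auto
      show ?thesis
      proof (cases "t \<in> N")
        case True
        obtain u w where "k = {u..w}" "u \<le> w" using pD(2,4)[OF tk(2)] by fastforce
        then have "0 \<le> ?len k" by simp
        then have "0 \<le> (K + e) * ?len k + (\<bar>K\<bar> + e) * ?len k"
          using \<open>e > 0\<close> by (simp add: distrib_right[symmetric])
        then show ?thesis using True tk by (simp add: q_def)
      next
        case False
        then show ?thesis using good[OF tk(2)] tk by (simp add: q_def)
      qed
    qed
    have total: "(\<Sum>xk\<in>p. \<psi> (Sup (snd xk)) - \<psi> (Inf (snd xk))) = \<psi> b - \<psi> a" for \<psi> :: "real \<Rightarrow> real"
      using additive_tagged_division_1[OF \<open>a \<le> b\<close> p(1), of \<psi>] by (simp add: split_beta)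
    have "p \<inter> q = q" by (auto simp: q_def)
    then have extra: "(\<Sum>xk\<in>p. if xk \<in> q then ?extra xk else 0) = sum ?extra q"
      using finp by (simp add: sum.If_cases)
    have "\<phi> b - \<phi> a \<le>
        (\<Sum>xk\<in>p. (K + e) * ?len (snd xk) + (if xk \<in> q then ?extra xk else 0))"
      unfolding total[of \<phi>, symmetric] by (rule sum_mono) (rule each)
    moreover have "(\<Sum>xk\<in>p. (K + e) * ?len (snd xk) + (if xk \<in> q then ?extra xk else 0)) =
        (K + e) * (b - a) + sum ?extra q"
      by (simp only: sum.distrib sum_distrib_left[symmetric] total[of "\<lambda>x. x"] extra)
    moreover have "sum ?extra q = (\<Sum>xk\<in>q. \<bar>?inc (snd xk)\<bar>) + (\<bar>K\<bar> + e) * (\<Sum>xk\<in>q. ?len (snd xk))"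
      by (simp only: sum.distrib sum_distrib_left)
    moreover have "(\<bar>K\<bar> + e) * (\<Sum>xk\<in>q. ?len (snd xk)) \<le> (\<bar>K\<bar> + e) * \<epsilon>"
      using lenq \<open>e > 0\<close> by (intro mult_left_mono) auto
    ultimately show "\<phi> b - \<phi> a \<le> (K + e) * (b - a) + 2 * e"
      using incq K\<epsilon> by linarith
  qed
  show ?thesis
  proof (rule field_le_epsilon)
    fix e :: real assume "e > 0"
    \<comment> \<open>Solves \<open>r * (b - a) + 2 * r = e\<close>, the total error in
      \<open>approx\<close>.\<close>
    define r where "r = e / (b - a + 2)"
    have "r > 0" "r * (b - a + 2) = e"
      using \<open>e > 0\<close> \<open>a \<le> b\<close> by (simp_all add: r_def)
    then show "\<phi> b - \<phi> a \<le> K * (b - a) + e"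
      using approx[of r] by (simp add: algebra_simps)
  qed
qed

section \<open>Convergence of saddle flows\<close>

text \<open>
  Only the energy inequality \<open>descent\<close> of a saddle flow is used, so the vector field itself never
  appears and no continuity of it is needed.  The condition \<open>flat\<close> says that the zero set of the
  dissipation \<open>\<Phi>(p, q\<^sub>*) - \<Phi>(p\<^sub>*, q)\<close> consists of points that do not push each other; it makes every
  limit point stationary, and the energy inequality at a stationary point is the saddle property.
\<close>

locale saddle_flow =
  fixes \<Phi> :: "'p::euclidean_space \<Rightarrow> 'q::euclidean_space \<Rightarrow> real"
    and C :: "'p set" and y :: "real \<Rightarrow> 'p \<times> 'q"
  assumes cont: "continuous_on UNIV (\<lambda>z. \<Phi> (fst z) (snd z))"
    and closed: "closed C"
    and inC: "\<And>t. 0 \<le> t \<Longrightarrow> fst (y t) \<in> C"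
    and descent: "\<And>w a b K. \<lbrakk>fst w \<in> C; 0 \<le> a; a \<le> b;
      \<And>t. \<lbrakk>a < t; t < b\<rbrakk> \<Longrightarrow> \<Phi> (fst w) (snd (y t)) - \<Phi> (fst (y t)) (snd w) \<le> K\<rbrakk> \<Longrightarrow>
      (norm (y b - w))\<^sup>2 / 2 - (norm (y a - w))\<^sup>2 / 2 \<le> K * (b - a)"
begin

text \<open>Bounds the rate of change of half the squared distance to \<open>w\<close> when the flow
  is at \<open>z\<close>. It is antisymmetric in its arguments; for a saddle point \<open>w\<close>
  and \<open>fst z\<close> in \<open>C\<close> its negative is the dissipation.\<close>

definition gap :: "'p \<times> 'q \<Rightarrow> 'p \<times> 'q \<Rightarrow> real"
  where "gap w z = \<Phi> (fst w) (snd z) - \<Phi> (fst z) (snd w)"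

lemma continuous_gap: "continuous_on UNIV (gap w)"
proof -
  have "continuous_on UNIV (\<lambda>z. (fst w, snd z))" "continuous_on UNIV (\<lambda>z. (fst z, snd w))"
    by (intro continuous_intros)+
  from this[THEN continuous_on_compose2[OF cont]]
  show ?thesis unfolding gap_def by (intro continuous_on_diff) auto
qed

lemma gap_tendsto:
  assumes "(X \<longlongrightarrow> z) F"
  shows "((\<lambda>n. gap w (X n)) \<longlongrightarrow> gap w z) F"
  using continuous_on_tendsto_compose[OF continuous_gap assms] by simp

lemma energy_increment:
  assumes "fst w \<in> C" "0 \<le> a" "a \<le> b" "\<And>t. \<lbrakk>a < t; t < b\<rbrakk> \<Longrightarrow> gap w (y t) \<le> K"
  shows "(norm (y b - w))\<^sup>2 / 2 - (norm (y a - w))\<^sup>2 / 2 \<le> K * (b - a)"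
  using descent[OF assms(1-3)] assms(4) unfolding gap_def by blast

text \<open>Test points sharing one component with \<open>s\<close> isolate each of the two saddle
  inequalities; conversely these chain through the value at \<open>s\<close>.\<close>

lemma saddle_iff_gap:
  "saddle_point_over \<Phi> C UNIV s \<longleftrightarrow> fst s \<in> C \<and> (\<forall>w. fst w \<in> C \<longrightarrow> 0 \<le> gap w s)"
proof
  assume "saddle_point_over \<Phi> C UNIV s"
  then show "fst s \<in> C \<and> (\<forall>w. fst w \<in> C \<longrightarrow> 0 \<le> gap w s)"
    unfolding saddle_point_over_def gap_def by (smt (verit) UNIV_I)
next
  assume *: "fst s \<in> C \<and> (\<forall>w. fst w \<in> C \<longrightarrow> 0 \<le> gap w s)"
  have "\<Phi> (fst s) q \<le> \<Phi> (fst s) (snd s)" for q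
    using * by (auto simp: gap_def dest!: spec[of _ "(fst s, q)"])
  moreover have "\<Phi> (fst s) (snd s) \<le> \<Phi> p (snd s)" if "p \<in> C" for p
    using * that by (auto simp: gap_def dest!: spec[of _ "(p, snd s)"])
  ultimately show "saddle_point_over \<Phi> C UNIV s"
    using * by (simp add: saddle_point_over_def)
qed

lemma distance_to_saddle_antimono:
  assumes "saddle_point_over \<Phi> C UNIV s" "0 \<le> a" "a \<le> b"
  shows "norm (y b - s) \<le> norm (y a - s)"
proof -
  \<comment> \<open>By antisymmetry this is \<open>saddle_iff_gap\<close> tested at
    \<open>y t\<close>.\<close>
  have "gap s (y t) \<le> 0" if "a < t" for t
    using assms(1,2) inC[of t] that unfolding saddle_iff_gap
    by (auto simp: gap_def dest: spec[of _ "y t"])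
  then have "(norm (y b - s))\<^sup>2 / 2 - (norm (y a - s))\<^sup>2 / 2 \<le> 0 * (b - a)"
    using assms by (intro energy_increment) (auto simp: saddle_iff_gap)
  then show ?thesis by (simp add: power_mono_iff)
qed

text \<open>Membership in the omega-limit set of the trajectory.\<close>

definition limit_point :: "'p \<times> 'q \<Rightarrow> bool"
  where "limit_point z \<longleftrightarrow> (\<exists>T. filterlim T at_top sequentially \<and> (\<lambda>n. y (T n)) \<longlonglongrightarrow> z)"

lemma limit_point_in_C:
  assumes "limit_point z"
  shows "fst z \<in> C"
proof -
  obtain T where T: "filterlim T at_top sequentially" "(\<lambda>n. y (T n)) \<longlonglongrightarrow> z"
    using assms unfolding limit_point_def by blast
  have "\<forall>\<^sub>F n in sequentially. fst (y (T n)) \<in> C"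
    using filterlim_at_top[THEN iffD1, OF T(1), rule_format, of 0] by eventually_elim (rule inC)
  then show ?thesis
    using Lim_in_closed_set[OF closed _ _ tendsto_fst[OF T(2)]] by simp
qed

lemma limit_point_exists:
  assumes s: "saddle_point_over \<Phi> C UNIV s" and T: "filterlim T at_top sequentially" "\<And>n. 0 \<le> T n"
  obtains z r where "limit_point z" "strict_mono r" "(\<lambda>n. y (T (r n))) \<longlonglongrightarrow> z"
proof -
  have "bounded (range (\<lambda>n. y (T n)))"
  proof (rule boundedI)
    fix x assume "x \<in> range (\<lambda>n. y (T n))"
    then obtain n where x: "x = y (T n)" by blast
    have "norm (y (T n) - s) \<le> norm (y 0 - s)"
      using distance_to_saddle_antimono[OF s order_refl T(2)] .
    then show "norm x \<le> norm (y 0 - s) + norm s"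
      unfolding x using norm_triangle_sub[of "y (T n)" s] by linarith
  qed
  then obtain z r where zr: "strict_mono r" "((\<lambda>n. y (T n)) \<circ> r) \<longlonglongrightarrow> z"
    using bounded_imp_convergent_subsequence by blast
  have "filterlim (\<lambda>n. T (r n)) at_top sequentially"
    using filterlim_compose[OF T(1) filterlim_subseq[OF zr(1)]] .
  then have "limit_point z"
    using zr(2) unfolding limit_point_def comp_def by blast
  then show ?thesis using that zr by (simp add: comp_def)
qed

text \<open>Compactness turns a sign at the limit points into a bound at all late times: otherwise
  times where \<open>gap w\<close> is at least \<open>e\<close> would accumulate at a limit point
  that violates \<open>le0\<close>.\<close>

lemma eventually_gap_le:
  assumes s: "saddle_point_over \<Phi> C UNIV s" and "e > 0"
    and le0: "\<And>z. limit_point z \<Longrightarrow> gap w z \<le> 0"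
  shows "\<forall>\<^sub>F t in at_top. gap w (y t) < e"
proof (rule ccontr)
  assume "\<not> ?thesis"
  then have "\<forall>n. \<exists>t\<ge>real n. e \<le> gap w (y t)"
    unfolding eventually_at_top_linorder by (meson not_less)
  then obtain T where T: "\<And>n. real n \<le> T n" "\<And>n. e \<le> gap w (y (T n))" by metis
  have "filterlim T at_top sequentially"
    by (rule filterlim_at_top_mono[OF filterlim_real_sequentially]) (simp add: T(1))
  moreover have "0 \<le> T n" for n using T(1)[of n] by linarith
  ultimately obtain z r where z: "limit_point z" "(\<lambda>n. y (T (r n))) \<longlonglongrightarrow> z"
    using limit_point_exists[OF s] by metis
  have "e \<le> gap w z"
    using LIMSEQ_le_const[OF gap_tendsto[OF z(2)]] T(2) by blast
  then show False using le0[OF z(1)] \<open>e > 0\<close> by linarith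
qed

text \<open>A drop of the distance to \<open>s\<close> by a fixed amount can happen only finitely often.\<close>

lemma gap_limit_point_eq_0:
  assumes s: "saddle_point_over \<Phi> C UNIV s" and z: "limit_point z"
  shows "gap s z = 0"
proof (rule ccontr)
  assume "gap s z \<noteq> 0"
  moreover have "gap s z \<le> 0"
    using s limit_point_in_C[OF z] unfolding saddle_iff_gap
    by (auto simp: gap_def dest: spec[of _ z])
  ultimately obtain c where c: "c > 0" "gap s z < - c"
    using that[of "- gap s z / 2"] by simp
  obtain T where T: "filterlim T at_top sequentially" "(\<lambda>n. y (T n)) \<longlonglongrightarrow> z"
    using z unfolding limit_point_def by blast
  have "\<forall>\<^sub>F x in nhds z. gap s x < - c"
    using order_tendstoD(2)[OF gap_tendsto[OF filterlim_ident] c(2)] .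
  then obtain r where r: "r > 0" "\<And>x. dist x z < r \<Longrightarrow> gap s x < - c"
    unfolding eventually_nhds_metric by blast
  have "bounded (y ` {0..})"
  proof (rule boundedI)
    fix x assume "x \<in> y ` {0..}"
    then obtain t where t: "0 \<le> t" "x = y t" by auto
    show "norm x \<le> norm (y 0 - s) + norm s"
      using distance_to_saddle_antimono[OF s order_refl t(1)] norm_triangle_sub[of "y t" s]
      unfolding t(2) by linarith
  qed
  then have "compact (closure (y ` {0..}))" by (simp add: compact_closure)
  then have "bounded (gap z ` closure (y ` {0..}))"
    by (intro compact_imp_bounded compact_continuous_image continuous_on_subset[OF continuous_gap]) auto
  then obtain K where K: "K > 0" "\<And>x. x \<in> closure (y ` {0..}) \<Longrightarrow> \<bar>gap z x\<bar> \<le> K"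
    unfolding bounded_pos by auto
  have gap_le: "gap z (y t) \<le> K" if "0 \<le> t" for t
  proof -
    have "y t \<in> closure (y ` {0..})" by (rule subsetD[OF closure_subset]) (simp add: that)
    then show ?thesis using K(2)[of "y t"] by linarith
  qed
  \<comment> \<open>With rate bound \<open>K\<close>, half the squared distance to \<open>z\<close>
    grows by at most r^2/8 during \<open>\<tau>\<close>. Started within \<open>r / 2\<close>, the
    squared distance therefore stays at most r^2/2.\<close>
  define \<tau> where "\<tau> = r\<^sup>2 / (8 * K)"
  have \<tau>: "\<tau> > 0" "K * \<tau> = r\<^sup>2 / 8" using r(1) K(1) by (auto simp: \<tau>_def)
  define V where "V t = (norm (y t - s))\<^sup>2 / 2" for t
  have drop: "V (T n + \<tau>) \<le> V (T n) - c * \<tau>" if n: "0 \<le> T n" "dist (y (T n)) z < r / 2" for n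
  proof -
    have near: "dist (y t) z < r" if t: "T n < t" "t < T n + \<tau>" for t
    proof -
      have "(norm (y t - z))\<^sup>2 / 2 - (norm (y (T n) - z))\<^sup>2 / 2 \<le> K * (t - T n)"
      proof (rule energy_increment)
        show "fst z \<in> C" by (rule limit_point_in_C[OF z])
        show "gap z (y u) \<le> K" if "T n < u" for u
          using gap_le[of u] n(1) that by linarith
      qed (use n(1) t in linarith)+
      moreover have "K * (t - T n) \<le> r\<^sup>2 / 8"
        unfolding \<tau>(2)[symmetric] using t K(1) by (intro mult_left_mono) auto
      ultimately have "(norm (y t - z))\<^sup>2 \<le> r\<^sup>2 / 4 + (norm (y (T n) - z))\<^sup>2"
        by linarith
      moreover have "(norm (y (T n) - z))\<^sup>2 \<le> (r / 2)\<^sup>2"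
        using n(2) by (intro power_mono) (auto simp: dist_norm)
      moreover have "(r / 2)\<^sup>2 = r\<^sup>2 / 4" "0 < r\<^sup>2"
        using r(1) by (simp_all add: power_divide)
      ultimately have "(norm (y t - z))\<^sup>2 < r\<^sup>2" by linarith
      then show ?thesis
        using power_less_imp_less_base[of "norm (y t - z)" 2 r] r(1) by (simp add: dist_norm)
    qed
    have "V (T n + \<tau>) - V (T n) \<le> - c * (T n + \<tau> - T n)"
      unfolding V_def
    proof (rule energy_increment)
      show "fst s \<in> C" using s unfolding saddle_iff_gap by blast
      show "gap s (y t) \<le> - c" if "T n < t" "t < T n + \<tau>" for t
        using r(2)[OF near[OF that]] by simp
    qed (use n(1) \<tau>(1) in linarith)+
    then show ?thesis by (simp add: algebra_simps)
  qed
  have V_mono: "V b \<le> V a" if "0 \<le> a" "a \<le> b" for a b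
    unfolding V_def using distance_to_saddle_antimono[OF s that] by (simp add: power_mono)
  have V_lim: "(\<lambda>n. V (T n)) \<longlonglongrightarrow> (norm (z - s))\<^sup>2 / 2"
    unfolding V_def by (intro tendsto_divide tendsto_power tendsto_norm tendsto_diff tendsto_const T(2)) simp
  \<comment> \<open>\<open>V\<close> is nonincreasing, so its limit along \<open>T\<close> bounds it
    from below at all times; a drop by \<open>c * \<tau>\<close> from just above that limit is then
    impossible.\<close>
  have V_ge: "(norm (z - s))\<^sup>2 / 2 \<le> V t" if "0 \<le> t" for t
  proof (rule tendsto_upperbound[OF V_lim])
    show "\<forall>\<^sub>F n in sequentially. V (T n) \<le> V t"
      using filterlim_at_top[THEN iffD1, OF T(1), rule_format, of t]
      by eventually_elim (rule V_mono[OF that])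
  qed simp
  have "\<forall>\<^sub>F n in sequentially. V (T n) < (norm (z - s))\<^sup>2 / 2 + c * \<tau>"
    using order_tendstoD(2)[OF V_lim] c(1) \<tau>(1) by simp
  moreover have "\<forall>\<^sub>F n in sequentially. dist (y (T n)) z < r / 2"
    using tendstoD[OF T(2), of "r / 2"] r(1) by simp
  moreover have "\<forall>\<^sub>F n in sequentially. 0 \<le> T n"
    using filterlim_at_top[THEN iffD1, OF T(1)] by blast
  ultimately have "\<forall>\<^sub>F n in sequentially. False"
  proof eventually_elim
    case (elim n)
    then show False using drop[of n] V_ge[of "T n + \<tau>"] \<tau>(1) by linarith
  qed
  then show False by simp
qed

text \<open>The stay near \<open>z\<close> must have a length that does not shrink with the radius:
  only then do both ends of the time interval tend to \<open>z\<close> while the energy relative to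
  \<open>w\<close> would fall by a fixed amount. A crude bound on \<open>gap z\<close> cannot give
  this; \<open>flat\<close> makes \<open>gap z\<close> nonpositive at all limit points, hence below
  any positive bound at late times.\<close>

lemma limit_point_is_saddle:
  assumes s: "saddle_point_over \<Phi> C UNIV s"
    and flat: "\<And>z w. \<lbrakk>fst z \<in> C; fst w \<in> C; gap s z = 0; gap s w = 0\<rbrakk> \<Longrightarrow> gap z w \<le> 0"
    and z: "limit_point z"
  shows "saddle_point_over \<Phi> C UNIV z"
  unfolding saddle_iff_gap
proof (intro conjI allI impI)
  show zC: "fst z \<in> C" by (rule limit_point_in_C[OF z])
  fix w :: "'p \<times> 'q" assume wC: "fst w \<in> C"
  obtain T where T: "filterlim T at_top sequentially" "(\<lambda>n. y (T n)) \<longlonglongrightarrow> z"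
    using z unfolding limit_point_def by blast
  have Tpos: "\<forall>\<^sub>F n in sequentially. 0 \<le> T n"
    using filterlim_at_top[THEN iffD1, OF T(1)] by blast
  have stay: "\<forall>\<^sub>F n in sequentially. \<forall>t\<in>{T n..T n + 1}. dist (y t) z < r" if "r > 0" for r
  proof -
    have "\<forall>\<^sub>F t in at_top. gap z (y t) < r\<^sup>2 / 4"
      using limit_point_in_C gap_limit_point_eq_0[OF s] flat z \<open>r > 0\<close>
      by (intro eventually_gap_le[OF s]) auto
    then obtain t0 where t0: "\<And>t. t \<ge> t0 \<Longrightarrow> gap z (y t) < r\<^sup>2 / 4"
      unfolding eventually_at_top_linorder by blast
    have "\<forall>\<^sub>F n in sequentially. t0 \<le> T n"
      using filterlim_at_top[THEN iffD1, OF T(1)] by blast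
    moreover have "\<forall>\<^sub>F n in sequentially. dist (y (T n)) z < r / 2"
      using tendstoD[OF T(2), of "r / 2"] \<open>r > 0\<close> by simp
    ultimately show ?thesis using Tpos
    proof eventually_elim
      case (elim n)
      have "dist (y t) z < r" if t: "T n \<le> t" "t \<le> T n + 1" for t
      proof -
        \<comment> \<open>At rate r^2/4 the squared distance gains at most r^2/2 in unit time, from
          at most r^2/4 at \<open>T n\<close>, and so stays below r^2.\<close>
        have "(norm (y t - z))\<^sup>2 / 2 - (norm (y (T n) - z))\<^sup>2 / 2 \<le> r\<^sup>2 / 4 * (t - T n)"
          using elim t zC t0 by (intro energy_increment) (auto simp: less_imp_le)
        also have "\<dots> \<le> r\<^sup>2 / 4 * 1" using t by (intro mult_left_mono) auto
        finally have "(norm (y t - z))\<^sup>2 \<le> r\<^sup>2 / 2 + (norm (y (T n) - z))\<^sup>2" by linarith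
        moreover have "(norm (y (T n) - z))\<^sup>2 \<le> (r / 2)\<^sup>2"
          using elim by (intro power_mono) (auto simp: dist_norm)
        moreover have "(r / 2)\<^sup>2 = r\<^sup>2 / 4" "0 < r\<^sup>2"
          using \<open>r > 0\<close> by (simp_all add: power_divide)
        ultimately have "(norm (y t - z))\<^sup>2 < r\<^sup>2" by linarith
        then show ?thesis
          using power_less_imp_less_base[of "norm (y t - z)" 2 r] \<open>r > 0\<close> by (simp add: dist_norm)
      qed
      then show ?case by simp
    qed
  qed
  show "0 \<le> gap w z"
  proof (rule ccontr)
    assume "\<not> 0 \<le> gap w z"
    then obtain c where c: "c > 0" "gap w z < - c"
      using that[of "- gap w z / 2"] by simp
    have "\<forall>\<^sub>F x in nhds z. gap w x < - c"
      using order_tendstoD(2)[OF gap_tendsto[OF filterlim_ident] c(2)] .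
    then obtain r where r: "r > 0" "\<And>x. dist x z < r \<Longrightarrow> gap w x < - c"
      unfolding eventually_nhds_metric by blast
    have "(\<lambda>n. y (T n + 1)) \<longlonglongrightarrow> z"
    proof (rule tendstoI)
      fix e :: real assume "e > 0"
      from stay[OF this] show "\<forall>\<^sub>F n in sequentially. dist (y (T n + 1)) z < e"
        by eventually_elim auto
    qed
    then have "(\<lambda>n. (norm (y (T n + 1) - w))\<^sup>2 / 2 - (norm (y (T n) - w))\<^sup>2 / 2)
        \<longlonglongrightarrow> (norm (z - w))\<^sup>2 / 2 - (norm (z - w))\<^sup>2 / 2"
      by (intro tendsto_divide tendsto_power tendsto_norm tendsto_diff tendsto_const T(2)) simp_all
    then have "\<forall>\<^sub>F n in sequentially. - c < (norm (y (T n + 1) - w))\<^sup>2 / 2 - (norm (y (T n) - w))\<^sup>2 / 2"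
      by (rule order_tendstoD(1)) (simp add: c(1))
    then have "\<forall>\<^sub>F n in sequentially. False"
      using stay[OF r(1)] Tpos
    proof eventually_elim
      case (elim n)
      have "(norm (y (T n + 1) - w))\<^sup>2 / 2 - (norm (y (T n) - w))\<^sup>2 / 2 \<le> - c * (T n + 1 - T n)"
        using elim wC r(2) by (intro energy_increment) (auto simp: less_imp_le)
      then show False using elim by simp
    qed
    then show False by simp
  qed
qed

theorem converges_to_saddle:
  assumes s: "saddle_point_over \<Phi> C UNIV s"
    and flat: "\<And>z w. \<lbrakk>fst z \<in> C; fst w \<in> C; gap s z = 0; gap s w = 0\<rbrakk> \<Longrightarrow> gap z w \<le> 0"
  shows "\<exists>z. saddle_point_over \<Phi> C UNIV z \<and> (y \<longlongrightarrow> z) at_top"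
proof -
  obtain z where z: "limit_point z"
    by (rule limit_point_exists[OF s filterlim_real_sequentially]) simp_all
  have sz: "saddle_point_over \<Phi> C UNIV z"
    by (rule limit_point_is_saddle[OF s flat z])
  obtain T where T: "filterlim T at_top sequentially" "(\<lambda>n. y (T n)) \<longlonglongrightarrow> z"
    using z unfolding limit_point_def by blast
  have "(y \<longlongrightarrow> z) at_top"
  proof (rule tendstoI)
    fix e :: real assume "e > 0"
    have "\<forall>\<^sub>F n in sequentially. dist (y (T n)) z < e \<and> 0 \<le> T n"
      using tendstoD[OF T(2) \<open>e > 0\<close>] filterlim_at_top[THEN iffD1, OF T(1), rule_format, of 0]
      by eventually_elim auto
    from eventually_happens'[OF sequentially_bot this]
    obtain n where n: "dist (y (T n)) z < e" "0 \<le> T n" by blast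
    then have "dist (y t) z < e" if "t \<ge> T n" for t
      using distance_to_saddle_antimono[OF sz n(2) that] by (simp add: dist_norm)
    then show "\<forall>\<^sub>F t in at_top. dist (y t) z < e"
      unfolding eventually_at_top_linorder by blast
  qed
  with sz show ?thesis by blast
qed

end

section \<open>Gradients, projections and Caratheodory solutions\<close>

text \<open>\<open>gradient\<close> is a definite description, so the representing vector must exist
  and be unique: it collects the values of the derivative on the basis, and the difference of two
  such vectors is orthogonal to itself.\<close>

lemma GDERIV_gradient:
  fixes \<phi> :: "'a::euclidean_space \<Rightarrow> real"
  assumes "\<phi> differentiable (at z)"
  shows "GDERIV \<phi> z :> gradient \<phi> z"
proof -
  obtain \<phi>' where \<phi>': "(\<phi> has_derivative \<phi>') (at z)"
    using assms unfolding differentiable_def by blast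
  interpret bounded_linear \<phi>' using \<phi>' by (rule has_derivative_bounded_linear)
  define D where "D = (\<Sum>b\<in>Basis. \<phi>' b *\<^sub>R b)"
  have "\<phi>' h = h \<bullet> D" for h
  proof -
    have "\<phi>' h = \<phi>' (\<Sum>b\<in>Basis. (h \<bullet> b) *\<^sub>R b)" by (simp add: euclidean_representation)
    also have "\<dots> = (\<Sum>b\<in>Basis. (h \<bullet> b) * \<phi>' b)" by (simp add: sum scaleR)
    finally show ?thesis by (simp add: D_def inner_sum_right mult.commute)
  qed
  then have "\<phi>' = (\<lambda>h. h \<bullet> D)" by (rule ext)
  then have "GDERIV \<phi> z :> D" using \<phi>' by (simp add: gderiv_def)
  moreover have "D' = D" if "GDERIV \<phi> z :> D'" for D'
  proof -
    have "(\<lambda>h. h \<bullet> D') = (\<lambda>h. h \<bullet> D)"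
      using that \<open>GDERIV \<phi> z :> D\<close> unfolding gderiv_def by (rule has_derivative_unique)
    then have "(D' - D) \<bullet> D' = (D' - D) \<bullet> D" by (rule fun_cong)
    then have "(D' - D) \<bullet> (D' - D) = 0" by (simp add: inner_diff_right)
    then show ?thesis by simp
  qed
  ultimately show ?thesis unfolding gradient_def by (rule theI)
qed

text \<open>By convexity the difference quotients along the segment from \<open>z\<close> to
  \<open>w\<close> never exceed the full increment; their limit at \<open>z\<close> inherits the
  bound.\<close>

lemma convex_on_gradient_le:
  fixes \<phi> :: "'a::euclidean_space \<Rightarrow> real"
  assumes "convex_on UNIV \<phi>" "\<phi> differentiable (at z)"
  shows "(w - z) \<bullet> gradient \<phi> z \<le> \<phi> w - \<phi> z"
proof -
  define \<psi> where "\<psi> t = \<phi> (z + t *\<^sub>R (w - z))" for t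
  have der: "(\<phi> has_derivative (\<lambda>h. h \<bullet> gradient \<phi> z)) (at (z + 0 *\<^sub>R (w - z)))"
    using GDERIV_gradient[OF assms(2)] by (simp add: gderiv_def)
  have aff: "((\<lambda>t::real. z + t *\<^sub>R (w - z)) has_derivative (\<lambda>t. t *\<^sub>R (w - z))) (at 0)"
    by (auto intro!: derivative_eq_intros)
  have "(\<psi> has_derivative (\<lambda>t. t *\<^sub>R (w - z) \<bullet> gradient \<phi> z)) (at 0)"
    using has_derivative_compose[OF aff der] unfolding \<psi>_def[abs_def] .
  moreover have "(\<lambda>t. t *\<^sub>R (w - z) \<bullet> gradient \<phi> z) = (*) ((w - z) \<bullet> gradient \<phi> z)"
    by (simp add: fun_eq_iff mult.commute)
  ultimately have "(\<psi> has_real_derivative (w - z) \<bullet> gradient \<phi> z) (at 0)"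
    by (simp add: has_field_derivative_def)
  then have lim: "((\<lambda>t. (\<psi> t - \<psi> 0) / t) \<longlongrightarrow> (w - z) \<bullet> gradient \<phi> z) (at_right 0)"
    unfolding has_field_derivative_iff by (auto intro: filterlim_mono at_le)
  show ?thesis
  proof (rule tendsto_upperbound[OF lim])
    show "\<forall>\<^sub>F t in at_right (0::real). (\<psi> t - \<psi> 0) / t \<le> \<phi> w - \<phi> z"
    proof (rule eventually_at_rightI[of 0 1])
      fix t :: real assume t: "t \<in> {0<..<1}"
      have eq: "z + t *\<^sub>R (w - z) = (1 - t) *\<^sub>R z + t *\<^sub>R w" by (simp add: algebra_simps)
      have "\<psi> t \<le> (1 - t) * \<phi> z + t * \<phi> w"
        unfolding \<psi>_def eq using t by (intro convex_onD[OF assms(1)]) auto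
      then have "\<psi> t - \<psi> 0 \<le> (\<phi> w - \<phi> z) * t" by (simp add: \<psi>_def algebra_simps)
      then show "(\<psi> t - \<psi> 0) / t \<le> \<phi> w - \<phi> z" using t by (simp add: pos_divide_le_eq)
    qed simp
  qed simp
qed

lemma concave_on_gradient_ge:
  fixes \<phi> :: "'a::euclidean_space \<Rightarrow> real"
  assumes "concave_on UNIV \<phi>" "\<phi> differentiable (at z)"
  shows "\<phi> w - \<phi> z \<le> (w - z) \<bullet> gradient \<phi> z"
proof -
  have diff: "(\<lambda>x. - \<phi> x) differentiable (at z)" using assms(2) by simp
  have "GDERIV (\<lambda>x. - \<phi> x) z :> - gradient \<phi> z"
    using GDERIV_gradient[OF assms(2)] by (rule GDERIV_minus)
  then have "(\<lambda>h. h \<bullet> gradient (\<lambda>x. - \<phi> x) z) = (\<lambda>h. h \<bullet> (- gradient \<phi> z))"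
    using GDERIV_gradient[OF diff] unfolding gderiv_def by (metis has_derivative_unique)
  then have "(w - z) \<bullet> gradient (\<lambda>x. - \<phi> x) z = - ((w - z) \<bullet> gradient \<phi> z)"
    by (metis inner_minus_right)
  then show ?thesis
    using convex_on_gradient_le[OF _ diff, of w] assms(1) by (simp add: concave_on_def)
qed

section \<open>Values of the projection operator\<close>

lemma has_projected_value_imp_mem:
  assumes "closed K" "K \<noteq> {}" and v: "has_projected_value K y w v"
  shows "y \<in> K"
proof (rule ccontr)
  assume "y \<notin> K"
  let ?d = "\<lambda>\<delta>. closest_point K (y + \<delta> *\<^sub>R w) - y"
  \<comment> \<open>The quotients converge, so their numerators tend to zero and points of
    \<open>K\<close> converge to \<open>y\<close>.\<close>
  have "((\<lambda>\<delta>. \<delta> *\<^sub>R (?d \<delta> /\<^sub>R \<delta>)) \<longlongrightarrow> 0 *\<^sub>R v) (at_right 0)"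
    using v unfolding has_projected_value_def by (intro tendsto_scaleR tendsto_ident_at) auto
  moreover have "\<forall>\<^sub>F \<delta> in at_right 0. \<delta> *\<^sub>R (?d \<delta> /\<^sub>R \<delta>) = ?d \<delta>"
    by (rule eventually_at_rightI[of 0 1]) auto
  ultimately have "(?d \<longlongrightarrow> 0) (at_right 0)"
    using tendsto_cong by force
  then have "((\<lambda>\<delta>. ?d \<delta> + y) \<longlongrightarrow> 0 + y) (at_right 0)"
    by (intro tendsto_add tendsto_const)
  then have lim: "((\<lambda>\<delta>. closest_point K (y + \<delta> *\<^sub>R w)) \<longlongrightarrow> y) (at_right 0)" by simp
  have "y \<in> K"
  proof (rule Lim_in_closed_set[OF \<open>closed K\<close> _ _ lim])
    show "\<forall>\<^sub>F \<delta> in at_right 0. closest_point K (y + \<delta> *\<^sub>R w) \<in> K"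
      using closest_point_in_set[OF assms(1,2)] by simp
  qed simp
  then show False using \<open>y \<notin> K\<close> by blast
qed

text \<open>The residual of a projection makes an obtuse angle with directions into
  \<open>K\<close>. Here it is \<open>\<delta>\<close> times the difference of \<open>w\<close> and
  the quotient; dividing by \<open>\<delta>\<close> and passing to the limit keeps the sign.\<close>

lemma has_projected_value_inner_le:
  assumes "closed K" "convex K" and y: "y \<in> K" and p: "p \<in> K"
    and v: "has_projected_value K y w v"
  shows "v \<bullet> (y - p) \<le> w \<bullet> (y - p)"
proof -
  let ?c = "\<lambda>\<delta>. closest_point K (y + \<delta> *\<^sub>R w)"
  have cont: "continuous (at y) (closest_point K)"
    using continuous_at_closest_point assms(1,2) y by blast
  have "((\<lambda>\<delta>. y + \<delta> *\<^sub>R w) \<longlongrightarrow> y + 0 *\<^sub>R w) (at_right 0)"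
    by (intro tendsto_intros)
  then have "(?c \<longlongrightarrow> closest_point K y) (at_right 0)"
    using continuous_within_tendsto_compose'[OF cont] by simp
  then have c: "(?c \<longlongrightarrow> y) (at_right 0)" using closest_point_self[OF y] by simp
  have lim: "((\<lambda>\<delta>. (w - (?c \<delta> - y) /\<^sub>R \<delta>) \<bullet> (p - ?c \<delta>)) \<longlongrightarrow> (w - v) \<bullet> (p - y)) (at_right 0)"
    using v unfolding has_projected_value_def by (intro tendsto_inner tendsto_diff tendsto_const c)
  have "(w - v) \<bullet> (p - y) \<le> 0"
  proof (rule tendsto_upperbound[OF lim])
    show "\<forall>\<^sub>F \<delta> in at_right 0. (w - (?c \<delta> - y) /\<^sub>R \<delta>) \<bullet> (p - ?c \<delta>) \<le> 0"
    proof (rule eventually_at_rightI[of 0 1])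
      fix \<delta> :: real assume \<delta>: "\<delta> \<in> {0<..<1}"
      have "(y + \<delta> *\<^sub>R w - ?c \<delta>) \<bullet> (p - ?c \<delta>) \<le> 0"
        by (rule closest_point_dot[OF assms(2,1) p])
      moreover have "y + \<delta> *\<^sub>R w - ?c \<delta> = \<delta> *\<^sub>R (w - (?c \<delta> - y) /\<^sub>R \<delta>)"
        using \<delta> by (simp add: scaleR_diff_right)
      ultimately show "(w - (?c \<delta> - y) /\<^sub>R \<delta>) \<bullet> (p - ?c \<delta>) \<le> 0"
        using \<delta> by (simp only: inner_scaleR_left) (auto simp: mult_le_0_iff)
    qed simp
  qed simp
  then show ?thesis by (simp add: inner_diff_left inner_diff_right)
qed

section \<open>Distances along Caratheodory solutions\<close>

lemma abs_continuous_on_half_square_distance: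
  fixes \<gamma> :: "real \<Rightarrow> 'a::real_inner"
  assumes ac: "abs_continuous_on a b \<gamma>"
  shows "abs_continuous_on a b (\<lambda>t. (norm (\<gamma> t - w))\<^sup>2 / 2)"
proof -
  have "compact (\<gamma> ` {a..b})"
    by (intro compact_continuous_image abs_continuous_on_imp_continuous_on[OF ac]) simp
  then obtain B where B: "B > 0" "\<And>t. t \<in> {a..b} \<Longrightarrow> norm (\<gamma> t) \<le> B"
    using compact_imp_bounded bounded_pos by (metis imageI)
  \<comment> \<open>Where \<open>\<gamma>\<close> is bounded by \<open>B\<close>, half the squared
    distance to \<open>w\<close> is Lipschitz with this constant.\<close>
  define M where "M = B + norm w"
  have M: "M > 0" using B(1) by (simp add: M_def add_pos_nonneg)
  have lip: "\<bar>(norm (\<gamma> t - w))\<^sup>2 / 2 - (norm (\<gamma> u - w))\<^sup>2 / 2\<bar> \<le> M * norm (\<gamma> t - \<gamma> u)"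
    if "t \<in> {a..b}" "u \<in> {a..b}" for t u
  proof -
    have "norm (\<gamma> t - w) \<le> M" "norm (\<gamma> u - w) \<le> M"
      using B(2) that norm_triangle_ineq4[of "\<gamma> t" w] norm_triangle_ineq4[of "\<gamma> u" w]
      unfolding M_def by fastforce+
    then have sum: "\<bar>norm (\<gamma> t - w) + norm (\<gamma> u - w)\<bar> \<le> 2 * M"
      using norm_ge_zero[of "\<gamma> t - w"] norm_ge_zero[of "\<gamma> u - w"] by linarith
    have diff: "\<bar>norm (\<gamma> t - w) - norm (\<gamma> u - w)\<bar> \<le> norm (\<gamma> t - \<gamma> u)"
      using norm_triangle_ineq3[of "\<gamma> t - w" "\<gamma> u - w"] by simp
    have "(norm (\<gamma> t - w))\<^sup>2 / 2 - (norm (\<gamma> u - w))\<^sup>2 / 2 =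
        (norm (\<gamma> t - w) + norm (\<gamma> u - w)) * (norm (\<gamma> t - w) - norm (\<gamma> u - w)) / 2"
      by (simp add: power2_eq_square algebra_simps)
    then have "\<bar>(norm (\<gamma> t - w))\<^sup>2 / 2 - (norm (\<gamma> u - w))\<^sup>2 / 2\<bar> =
        \<bar>norm (\<gamma> t - w) + norm (\<gamma> u - w)\<bar> * \<bar>norm (\<gamma> t - w) - norm (\<gamma> u - w)\<bar> / 2"
      by (simp only: abs_divide abs_mult abs_numeral)
    moreover have "\<bar>norm (\<gamma> t - w) + norm (\<gamma> u - w)\<bar> * \<bar>norm (\<gamma> t - w) - norm (\<gamma> u - w)\<bar> \<le>
        (2 * M) * norm (\<gamma> t - \<gamma> u)"
      using sum diff M by (intro mult_mono) auto
    ultimately show ?thesis by linarith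
  qed
  show ?thesis
    unfolding abs_continuous_on_def
  proof (intro allI impI)
    fix e :: real assume "e > 0"
    then have "e / M > 0" using M by simp
    then obtain \<delta> where \<delta>: "\<delta> > 0"
      "\<And>D S. D division_of S \<Longrightarrow> S \<subseteq> {a..b} \<Longrightarrow> (\<Sum>I\<in>D. Sup I - Inf I) < \<delta> \<Longrightarrow>
        (\<Sum>I\<in>D. norm (\<gamma> (Sup I) - \<gamma> (Inf I))) < e / M"
      using ac unfolding abs_continuous_on_def by metis
    have "(\<Sum>I\<in>D. norm ((norm (\<gamma> (Sup I) - w))\<^sup>2 / 2 - (norm (\<gamma> (Inf I) - w))\<^sup>2 / 2)) < e"
      if D: "D division_of S" "S \<subseteq> {a..b}" "(\<Sum>I\<in>D. Sup I - Inf I) < \<delta>" for D S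
    proof -
      have "(\<Sum>I\<in>D. norm ((norm (\<gamma> (Sup I) - w))\<^sup>2 / 2 - (norm (\<gamma> (Inf I) - w))\<^sup>2 / 2)) \<le>
          (\<Sum>I\<in>D. M * norm (\<gamma> (Sup I) - \<gamma> (Inf I)))"
      proof (rule sum_mono)
        fix I assume I: "I \<in> D"
        obtain u t where ut: "I = cbox u t" "I \<noteq> {}" "I \<subseteq> S"
          using division_ofD(2-4)[OF D(1) I] by blast
        then have "Sup I \<in> S" "Inf I \<in> S" by auto
        then have "Sup I \<in> {a..b}" "Inf I \<in> {a..b}" using D(2) by blast+
        then show "norm ((norm (\<gamma> (Sup I) - w))\<^sup>2 / 2 - (norm (\<gamma> (Inf I) - w))\<^sup>2 / 2) \<le>
            M * norm (\<gamma> (Sup I) - \<gamma> (Inf I))"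
          unfolding real_norm_def by (rule lip)
      qed
      also have "\<dots> = M * (\<Sum>I\<in>D. norm (\<gamma> (Sup I) - \<gamma> (Inf I)))" by (simp only: sum_distrib_left)
      also have "\<dots> < M * (e / M)" using M \<delta>(2)[OF D] by (intro mult_strict_left_mono)
      finally show ?thesis using M by simp
    qed
    then show "\<exists>\<delta>>0. \<forall>D S. D division_of S \<and> S \<subseteq> {a..b} \<and> (\<Sum>I\<in>D. Sup I - Inf I) < \<delta> \<longrightarrow>
        (\<Sum>I\<in>D. norm ((norm (\<gamma> (Sup I) - w))\<^sup>2 / 2 - (norm (\<gamma> (Inf I) - w))\<^sup>2 / 2)) < e"
      using \<delta>(1) by blast
  qed
qed

lemma caratheodory_solution_continuous_on:
  assumes "caratheodory_solution R \<gamma>"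
  shows "continuous_on {0..T} \<gamma>"
proof (cases "T > 0")
  case True
  then show ?thesis
    using assms abs_continuous_on_imp_continuous_on unfolding caratheodory_solution_def by blast
next
  case False
  then have "{0..T} \<subseteq> {0}" by auto
  then show ?thesis by (rule continuous_on_subset[OF continuous_on_sing])
qed

text \<open>The chain rule gives half the squared distance the derivative
  \<open>d \<bullet> (\<gamma> t - w)\<close> almost everywhere; absolute continuity turns the bound
  on it into one on the increment.\<close>

lemma caratheodory_solution_energy:
  fixes \<gamma> :: "real \<Rightarrow> 'a::real_inner"
  assumes sol: "caratheodory_solution R \<gamma>" and ab: "0 \<le> a" "a \<le> b"
    and le: "\<And>t d. \<lbrakk>a < t; t < b; R (\<gamma> t) d\<rbrakk> \<Longrightarrow> d \<bullet> (\<gamma> t - w) \<le> K"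
  shows "(norm (\<gamma> b - w))\<^sup>2 / 2 - (norm (\<gamma> a - w))\<^sup>2 / 2 \<le> K * (b - a)"
proof (cases "a = b")
  case False
  then have "b > 0" using ab by simp
  then have ac: "abs_continuous_on a b (\<lambda>t. (norm (\<gamma> t - w))\<^sup>2 / 2)"
    using sol ab(1) unfolding caratheodory_solution_def
    by (intro abs_continuous_on_half_square_distance) (auto intro: abs_continuous_on_subset)
  have ae: "AE t in lebesgue. 0 < t \<longrightarrow> (\<exists>d. (\<gamma> has_vector_derivative d) (at t) \<and> R (\<gamma> t) d)"
    using sol unfolding caratheodory_solution_def by blast
  show ?thesis
  proof (rule abs_continuous_on_increment_le[OF ac ab(2)])
    show "AE t in lebesgue. a < t \<and> t < b \<longrightarrow>
        (\<exists>d\<le>K. ((\<lambda>t. (norm (\<gamma> t - w))\<^sup>2 / 2) has_real_derivative d) (at t))"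
      using ae
    proof eventually_elim
      case (elim t)
      show ?case
      proof
        assume t: "a < t \<and> t < b"
        then obtain d where d: "(\<gamma> has_vector_derivative d) (at t)" "R (\<gamma> t) d"
          using elim ab(1) by auto
        have "((\<lambda>t. (\<gamma> t - w) \<bullet> (\<gamma> t - w) / 2) has_derivative (\<lambda>h. (d \<bullet> (\<gamma> t - w)) * h)) (at t)"
          using d(1) unfolding has_vector_derivative_def
          by (auto intro!: derivative_eq_intros simp: inner_commute)
        then have "((\<lambda>t. (norm (\<gamma> t - w))\<^sup>2 / 2) has_real_derivative d \<bullet> (\<gamma> t - w)) (at t)"
          by (simp add: has_field_derivative_def power2_norm_eq_inner)
        then show "\<exists>d\<le>K. ((\<lambda>t. (norm (\<gamma> t - w))\<^sup>2 / 2) has_real_derivative d) (at t)"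
          using le d(2) t by blast
      qed
    qed
  qed
qed simp

text \<open>The equation itself forces invariance: the right-hand side has values only in states of
  \<open>K\<close>, so almost every time lies in the preimage of \<open>K\<close>, and a closed set
  containing almost every point of an open interval contains all of them.\<close>

lemma caratheodory_solution_mem_closed:
  assumes sol: "caratheodory_solution R \<gamma>" and "closed K" and "\<gamma> 0 \<in> K"
    and mem: "\<And>y d. R y d \<Longrightarrow> y \<in> K" and "0 \<le> t"
  shows "\<gamma> t \<in> K"
proof (cases "t = 0")
  case False
  \<comment> \<open>Clamping time to \<open>{0..t + 1}\<close> gives continuity on the whole line;
    the extra unit makes \<open>t\<close> an interior time.\<close>
  define \<gamma>' where "\<gamma>' u = \<gamma> (max 0 (min (t + 1) u))" for u
  have "continuous_on UNIV \<gamma>'"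
    unfolding \<gamma>'_def
    by (rule continuous_on_compose2[OF caratheodory_solution_continuous_on[OF sol, of "t + 1"]])
      (use \<open>0 \<le> t\<close> in \<open>auto intro!: continuous_intros\<close>)
  then have "closed (\<gamma>' -` K)" using \<open>closed K\<close> continuous_closed_vimage
    by (simp add: continuous_on_closed_vimage)
  moreover have "AE u \<in> {0<..<t + 1} in lebesgue. u \<in> \<gamma>' -` K"
  proof -
    have "AE u in lebesgue. 0 < u \<longrightarrow> (\<exists>d. (\<gamma> has_vector_derivative d) (at u) \<and> R (\<gamma> u) d)"
      using sol unfolding caratheodory_solution_def by blast
    then show ?thesis
      by eventually_elim (auto simp: \<gamma>'_def dest: mem)
  qed
  moreover have "t \<in> {0<..<t + 1}" using False \<open>0 \<le> t\<close> by simp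
  ultimately have "t \<in> \<gamma>' -` K"
    using mem_closed_if_AE_lebesgue_open[OF open_greaterThanLessThan] by blast
  then show ?thesis using \<open>0 \<le> t\<close> by (simp add: \<gamma>'_def)
qed (use assms in simp)

section \<open>Laplacians\<close>

text \<open>A zero of a nonnegative form is a minimum. Moving from \<open>x\<close> against
  \<open>u = M *v x\<close> by \<open>t\<close> has first-order effect
  \<open>- 2 * t * (u \<bullet> u)\<close>, which would make the form negative for small
  \<open>t\<close> unless \<open>u\<close> is zero.\<close>

lemma psd_kernel:
  fixes M :: "real^'a^'a"
  assumes sym: "transpose M = M" and psd: "\<And>x. 0 \<le> x \<bullet> (M *v x)" and "x \<bullet> (M *v x) = 0"
  shows "M *v x = 0"
proof -
  define u where "u = M *v x"
  have Msym: "a \<bullet> (M *v b) = (M *v a) \<bullet> b" for a b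
    by (metis dot_lmul_matrix sym transpose_matrix_vector)
  have quad: "0 \<le> - 2 * t * (u \<bullet> u) + t\<^sup>2 * (u \<bullet> (M *v u))" for t
  proof -
    have "(x - t *\<^sub>R u) \<bullet> (M *v (x - t *\<^sub>R u)) =
        x \<bullet> (M *v x) - t * (u \<bullet> (M *v x)) - t * (x \<bullet> (M *v u)) + t\<^sup>2 * (u \<bullet> (M *v u))"
      by (simp add: matrix_vector_mult_diff_distrib matrix_vector_mult_scaleR inner_diff_left
          inner_diff_right power2_eq_square algebra_simps)
    also have "x \<bullet> (M *v u) = u \<bullet> u" by (simp add: Msym u_def)
    also have "u \<bullet> (M *v x) = u \<bullet> u" by (simp add: u_def)
    finally show ?thesis using psd[of "x - t *\<^sub>R u"] assms(3) by simp
  qed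
  have "u \<bullet> u = 0"
  proof (rule ccontr)
    assume "u \<bullet> u \<noteq> 0"
    then have pos: "u \<bullet> u > 0" by simp
    define q where "q = u \<bullet> (M *v u)"
    have "q \<ge> 0" unfolding q_def by (rule psd)
    \<comment> \<open>Small enough that \<open>t * q\<close> stays below
      \<open>2 * (u \<bullet> u)\<close>; the added 1 covers \<open>q = 0\<close>.\<close>
    define t where "t = (u \<bullet> u) / (q + 1)"
    have "t > 0" using pos \<open>q \<ge> 0\<close> by (simp add: t_def)
    have "t * (2 * (u \<bullet> u)) \<le> t * (t * q)"
      using quad[of t] by (simp add: q_def power2_eq_square algebra_simps)
    then have "2 * (u \<bullet> u) \<le> t * q" using \<open>t > 0\<close> by simp
    also have "\<dots> \<le> t * (q + 1)" using \<open>t > 0\<close> by simp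
    also have "\<dots> = u \<bullet> u" using \<open>q \<ge> 0\<close> by (simp add: t_def)
    finally show False using pos by simp
  qed
  then show ?thesis by (simp add: u_def)
qed

text \<open>The parallelogram law of a quadratic form; its last term is the margin of strict
  convexity across the kernel.\<close>

lemma psd_quadratic_midpoint:
  fixes M :: "real^'a^'a"
  assumes "transpose M = M"
  shows "((1/2) *\<^sub>R (x + y)) \<bullet> (M *v ((1/2) *\<^sub>R (x + y))) =
    (x \<bullet> (M *v x)) / 2 + (y \<bullet> (M *v y)) / 2 - ((x - y) \<bullet> (M *v (x - y))) / 4"
  by (simp add: matrix_vector_mult_diff_distrib matrix_vector_mult_scaleR matrix_vector_right_distrib
      inner_diff_left inner_diff_right inner_add_left inner_add_right field_simps)

lemma convex_on_psd_quadratic: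
  fixes M :: "real^'a^'a"
  assumes psd: "\<And>x. 0 \<le> x \<bullet> (M *v x)"
  shows "convex_on UNIV (\<lambda>x. x \<bullet> (M *v x))"
proof (rule convex_onI)
  fix t :: real and x y :: "real^'a"
  assume t: "0 < t" "t < 1"
  have "((1 - t) *\<^sub>R x + t *\<^sub>R y) \<bullet> (M *v ((1 - t) *\<^sub>R x + t *\<^sub>R y)) =
      (1 - t) * (x \<bullet> (M *v x)) + t * (y \<bullet> (M *v y)) - t * (1 - t) * ((x - y) \<bullet> (M *v (x - y)))"
    by (simp add: matrix_vector_mult_diff_distrib matrix_vector_mult_scaleR matrix_vector_right_distrib
        inner_diff_left inner_diff_right inner_add_left inner_add_right algebra_simps)
  moreover have "0 \<le> t * (1 - t) * ((x - y) \<bullet> (M *v (x - y)))"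
    using t psd by simp
  ultimately show "((1 - t) *\<^sub>R x + t *\<^sub>R y) \<bullet> (M *v ((1 - t) *\<^sub>R x + t *\<^sub>R y)) \<le>
      (1 - t) * (x \<bullet> (M *v x)) + t * (y \<bullet> (M *v y))" by linarith
qed simp

lemma laplacian_symmetric:
  assumes "transpose A = A"
  shows "transpose (laplacian A) = laplacian A"
proof -
  have "A $ i $ j = A $ j $ i" for i j
    using assms by (metis transpose_def vec_lambda_beta)
  then show ?thesis by (simp add: vec_eq_iff transpose_def laplacian_def)
qed

lemma laplacian_mult_nth: "(laplacian A *v x) $ i = (\<Sum>j\<in>UNIV. A $ i $ j * (x $ i - x $ j))"
proof -
  have "(laplacian A *v x) $ i =
      (\<Sum>j\<in>UNIV. (if i = j then (\<Sum>k\<in>UNIV. A $ i $ k) * x $ j else 0) - A $ i $ j * x $ j)"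
    unfolding matrix_vector_mult_def laplacian_def
    by (auto intro!: sum.cong simp: left_diff_distrib)
  also have "\<dots> = (\<Sum>k\<in>UNIV. A $ i $ k) * x $ i - (\<Sum>j\<in>UNIV. A $ i $ j * x $ j)"
    by (simp add: sum_subtractf)
  finally show ?thesis by (simp add: sum_distrib_right right_diff_distrib sum_subtractf)
qed

text \<open>Symmetrizing the double sum in \<open>i\<close> and \<open>j\<close> shows twice the
  form to be a weighted sum of squared differences.\<close>

lemma laplacian_psd:
  assumes sym: "transpose A = A" and nonneg: "\<And>i j. 0 \<le> A $ i $ j"
  shows "0 \<le> x \<bullet> (laplacian A *v x)"
proof -
  let ?S = "\<Sum>i\<in>UNIV. \<Sum>j\<in>UNIV. A $ i $ j * x $ i * (x $ i - x $ j)"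
  have S: "x \<bullet> (laplacian A *v x) = ?S"
    by (simp add: inner_vec_def laplacian_mult_nth sum_distrib_left mult_ac)
  have A: "A $ i $ j = A $ j $ i" for i j
    using sym by (metis transpose_def vec_lambda_beta)
  have "?S = (\<Sum>j\<in>UNIV. \<Sum>i\<in>UNIV. A $ i $ j * x $ i * (x $ i - x $ j))" by (rule sum.swap)
  also have "\<dots> = (\<Sum>i\<in>UNIV. \<Sum>j\<in>UNIV. A $ i $ j * x $ j * (x $ j - x $ i))"
    by (intro sum.cong refl) (simp add: A)
  finally have "2 * ?S = (\<Sum>i\<in>UNIV. \<Sum>j\<in>UNIV. A $ i $ j * x $ i * (x $ i - x $ j))
      + (\<Sum>i\<in>UNIV. \<Sum>j\<in>UNIV. A $ i $ j * x $ j * (x $ j - x $ i))" by linarith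
  also have "\<dots> = (\<Sum>i\<in>UNIV. \<Sum>j\<in>UNIV. A $ i $ j * (x $ i - x $ j)\<^sup>2)"
    unfolding sum.distrib[symmetric]
    by (intro sum.cong refl) (simp add: power2_eq_square algebra_simps)
  also have "\<dots> \<ge> 0" using nonneg by (intro sum_nonneg) simp
  finally show ?thesis unfolding S by simp
qed

text \<open>The identity factor decouples the coordinates: \<open>M\<close> acts separately on each
  slice of entries with a common second index.\<close>

lemma kronecker_mat_1_mult_nth:
  fixes M :: "real^'b::finite^'a::finite"
  shows "((M \<otimes>\<^sub>K (mat 1 :: real^'d::finite^'d)) *v x) $ (i, a) = (M *v (\<chi> j. x $ (j, a))) $ i"
proof -
  have "((M \<otimes>\<^sub>K (mat 1 :: real^'d^'d)) *v x) $ (i, a) =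
      (\<Sum>q\<in>UNIV. M $ i $ fst q * (if a = snd q then 1 else 0) * x $ q)"
    by (simp add: matrix_vector_mult_def kronecker_product_def mat_def)
  also have "\<dots> = (\<Sum>j\<in>UNIV. \<Sum>b\<in>UNIV. M $ i $ j * (if a = b then 1 else 0) * x $ (j, b))"
    unfolding UNIV_Times_UNIV[symmetric] sum.cartesian_product by (simp add: split_beta)
  also have "\<dots> = (\<Sum>j\<in>UNIV. M $ i $ j * x $ (j, a))"
    by (intro sum.cong refl) (simp add: if_distrib[of "\<lambda>c. _ * c * _"] cong: if_cong)
  finally show ?thesis by (simp add: matrix_vector_mult_def)
qed

lemma kronecker_mat_1_symmetric:
  assumes "transpose M = M"
  shows "transpose (M \<otimes>\<^sub>K (mat 1 :: real^'d::finite^'d)) = M \<otimes>\<^sub>K mat 1"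
proof -
  have "M $ i $ j = M $ j $ i" for i j
    using assms by (metis transpose_def vec_lambda_beta)
  then show ?thesis by (simp add: vec_eq_iff transpose_def kronecker_product_def mat_def)
qed

lemma kronecker_mat_1_psd:
  fixes M :: "real^'a::finite^'a"
  assumes psd: "\<And>x. 0 \<le> x \<bullet> (M *v x)"
  shows "0 \<le> x \<bullet> ((M \<otimes>\<^sub>K (mat 1 :: real^'d::finite^'d)) *v x)"
proof -
  let ?col = "\<lambda>a. \<chi> j. x $ (j, a)"
  have "x \<bullet> ((M \<otimes>\<^sub>K (mat 1 :: real^'d^'d)) *v x) =
      (\<Sum>i\<in>UNIV. \<Sum>a\<in>UNIV. x $ (i, a) * (M *v ?col a) $ i)"
    unfolding inner_vec_def UNIV_Times_UNIV[symmetric] sum.cartesian_product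
    by (intro sum.cong refl) (auto simp: kronecker_mat_1_mult_nth)
  also have "\<dots> = (\<Sum>a\<in>UNIV. ?col a \<bullet> (M *v ?col a))"
    by (subst sum.swap) (simp add: inner_vec_def)
  also have "\<dots> \<ge> 0" by (intro sum_nonneg psd)
  finally show ?thesis .
qed

section \<open>The augmented Lagrangian\<close>

lemma convex_on_sum_functions:
  assumes "finite I" "convex S" "\<And>i. i \<in> I \<Longrightarrow> convex_on S (F i)"
  shows "convex_on S (\<lambda>x. \<Sum>i\<in>I. F i x)"
  using assms(1,3) by (induction I) (auto simp: assms(2) convex_on_const intro: convex_on_add)

lemma convex_on_compose_linear:
  fixes \<phi> :: "'b::real_vector \<Rightarrow> real"
  assumes "convex_on UNIV \<phi>" "linear g"
  shows "convex_on UNIV (\<lambda>x. \<phi> (g x))"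
proof (rule convex_onI)
  fix t :: real and x y
  assume "0 < t" "t < 1"
  then show "\<phi> (g ((1 - t) *\<^sub>R x + t *\<^sub>R y)) \<le> (1 - t) * \<phi> (g x) + t * \<phi> (g y)"
    using convex_onD[OF assms(1), of t "g x" "g y"] assms(2) by (simp add: linear_add linear_scale)
qed simp

lemma convex_on_linear: "linear g \<Longrightarrow> convex_on UNIV g" for g :: "'a::real_vector \<Rightarrow> real"
  by (rule convex_onI) (auto simp: linear_add linear_scale)

lemma norm_square_midpoint:
  fixes a b c :: "'a::real_inner"
  shows "(norm ((1/2) *\<^sub>R (a + b) - c))\<^sup>2 =
    (norm (a - c))\<^sup>2 / 2 + (norm (b - c))\<^sup>2 / 2 - (norm (a - b))\<^sup>2 / 4"
  by (simp add: power2_norm_eq_inner inner_diff_left inner_diff_right inner_add_left inner_add_right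
      inner_commute field_simps)

lemma convex_on_norm_square:
  fixes c :: "'a::real_inner"
  shows "convex_on UNIV (\<lambda>z. (norm (z - c))\<^sup>2)"
proof (rule convex_onI)
  fix t :: real and x y :: 'a
  assume t: "0 < t" "t < 1"
  have "(norm ((1 - t) *\<^sub>R x + t *\<^sub>R y - c))\<^sup>2 =
      (1 - t) * (norm (x - c))\<^sup>2 + t * (norm (y - c))\<^sup>2 - t * (1 - t) * (norm (x - y))\<^sup>2"
    by (simp add: power2_norm_eq_inner inner_diff_left inner_diff_right inner_add_left inner_add_right
        inner_commute algebra_simps)
  moreover have "0 \<le> t * (1 - t) * (norm (x - y))\<^sup>2" using t by simp
  ultimately show "(norm ((1 - t) *\<^sub>R x + t *\<^sub>R y - c))\<^sup>2 \<le>
      (1 - t) * (norm (x - c))\<^sup>2 + t * (norm (y - c))\<^sup>2" by linarith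
qed simp

lemma differentiable_norm_square:
  fixes c :: "'a::real_inner"
  shows "(\<lambda>z. (norm (z - c))\<^sup>2) differentiable (at z)"
proof -
  have "((\<lambda>z. (z - c) \<bullet> (z - c)) has_derivative (\<lambda>h. (z - c) \<bullet> h + h \<bullet> (z - c))) (at z)"
    by (auto intro!: derivative_eq_intros)
  then show ?thesis unfolding power2_norm_eq_inner differentiable_def by blast
qed

lemma linear_imp_differentiable:
  fixes g :: "'a::euclidean_space \<Rightarrow> 'b::real_normed_vector"
  shows "linear g \<Longrightarrow> g differentiable (at z)"
  by (intro bounded_linear_imp_differentiable) (simp add: linear_conv_bounded_linear)

lemma linear_block: "linear (\<lambda>x. block x i)"
  by (rule linearI) (simp_all add: block_def vec_eq_iff)

lemma linear_inner_matrix: "linear (\<lambda>x. a \<bullet> (M *v x))" for M :: "real^'a^'b"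
  by (rule linearI) (simp_all add: matrix_vector_right_distrib matrix_vector_mult_scaleR inner_add_right)

lemma differentiable_quadratic: "(\<lambda>x. x \<bullet> (M *v x)) differentiable (at z)" for M :: "real^'a^'a"
proof -
  have "((*v) M has_derivative (*v) M) (at z)"
    by (rule bounded_linear_imp_has_derivative) simp
  then have "((\<lambda>x. x \<bullet> (M *v x)) has_derivative (\<lambda>h. z \<bullet> (M *v h) + h \<bullet> (M *v z))) (at z)"
    by (intro has_derivative_inner has_derivative_ident)
  then show ?thesis unfolding differentiable_def by blast
qed

section \<open>The constraint set\<close>

lemma closed_C_set: "closed C_set"
proof -
  have "closed {l :: real^'n. \<forall>i. 0 \<le> l $ i}"
    by (intro closed_Collect_all closed_Collect_le continuous_intros)
  then show ?thesis unfolding C_set_def by (intro closed_Times) auto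
qed

lemma convex_C_set: "convex C_set"
proof -
  have "convex {l :: real^'n. \<forall>i. 0 \<le> l $ i}"
    by (rule convexI) (auto intro!: add_nonneg_nonneg mult_nonneg_nonneg)
  then show ?thesis unfolding C_set_def by (intro convex_Times) auto
qed

lemma mem_C_set: "(x, l) \<in> C_set \<longleftrightarrow> (\<forall>i. 0 \<le> l $ i)"
  by (simp add: C_set_def)

text \<open>The source of invariance: off the constraint set the projected field has no value, so a
  solution can be there only for a null set of positive times.\<close>

lemma sp_field_imp_mem_C_set:
  assumes "sp_field f \<epsilon> L v \<xi>hat y d"
  shows "y \<in> C_set \<times> UNIV"
proof -
  obtain x l \<nu> \<eta> \<xi> where y: "y = ((x, l), (\<nu>, \<eta>, \<xi>))" by (metis prod.exhaust)
  obtain dp d\<nu> d\<eta> d\<xi> where d: "d = (dp, (d\<nu>, d\<eta>, d\<xi>))" by (metis prod.exhaust)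
  have "(0, 0) \<in> C_set" by (simp add: mem_C_set)
  then have "C_set \<noteq> {}" by blast
  note field = assms[unfolded y d sp_field.simps]
  show ?thesis
    using has_projected_value_imp_mem[OF closed_C_set \<open>C_set \<noteq> {}\<close> field[THEN conjunct1]]
    by (simp add: y)
qed

section \<open>The augmented Lagrangian as a saddle function\<close>

locale augmented_lagrangian =
  fixes f :: "real^'d \<Rightarrow> real^'m \<Rightarrow> real" and \<epsilon> :: real and L :: "real^'n::finite^'n"
    and v :: "'N::finite \<Rightarrow> 'n" and \<xi>hat :: "'N \<Rightarrow> real^'m"
  assumes L_symmetric: "transpose L = L" and L_psd: "\<And>l. 0 \<le> l \<bullet> (L *v l)"
    and f_differentiable: "\<And>z. (\<lambda>(x, \<xi>). f x \<xi>) differentiable (at z)"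
    and f_convex: "\<And>\<xi>. convex_on UNIV (\<lambda>x. f x \<xi>)"
    and f_concave: "\<And>x. concave_on UNIV (\<lambda>\<xi>. f x \<xi>)"
begin

abbreviation M :: "real^('n \<times> 'd)^('n \<times> 'd)" where "M \<equiv> L \<otimes>\<^sub>K mat 1"

abbreviation Laug where "Laug \<equiv> L_aug f \<epsilon> L v \<xi>hat"

definition \<Phi> :: "(real^('n \<times> 'd)) \<times> (real^'n) \<Rightarrow> (real^'n) \<times> (real^('n \<times> 'd)) \<times> (real^'m^'N) \<Rightarrow> real"
  where "\<Phi> = (\<lambda>(x, l) (\<nu>, \<eta>, \<xi>). Laug x l \<nu> \<eta> \<xi>)"

lemma \<Phi>_simp [simp]: "\<Phi> (x, l) (\<nu>, \<eta>, \<xi>) = Laug x l \<nu> \<eta> \<xi>"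
  by (simp add: \<Phi>_def)

lemma saddle_point_iff: "L_aug_saddle_point f \<epsilon> L v \<xi>hat s \<longleftrightarrow> saddle_point_over \<Phi> C_set UNIV s"
  by (simp add: L_aug_saddle_point_def \<Phi>_def)

lemma M_symmetric: "transpose M = M"
  by (rule kronecker_mat_1_symmetric[OF L_symmetric])

lemma M_psd: "0 \<le> x \<bullet> (M *v x)"
  by (rule kronecker_mat_1_psd[OF L_psd])

lemma f_slice_differentiable:
  "(\<lambda>x. f x \<xi>) differentiable (at x0)" "(\<lambda>\<xi>. f x \<xi>) differentiable (at \<xi>0)"
proof -
  have pair: "(\<lambda>x. (x, \<xi>)) differentiable (at x0)" "(\<lambda>\<xi>. (x, \<xi>)) differentiable (at \<xi>0)"
    unfolding differentiable_def by (auto intro!: derivative_eq_intros exI)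
  show "(\<lambda>x. f x \<xi>) differentiable (at x0)" "(\<lambda>\<xi>. f x \<xi>) differentiable (at \<xi>0)"
    using differentiable_compose[OF f_differentiable pair(1)]
      differentiable_compose[OF f_differentiable pair(2)] by simp_all
qed

lemma continuous_on_f: "continuous_on UNIV (\<lambda>z. f (fst z) (snd z))"
  using f_differentiable
  by (intro continuous_at_imp_continuous_on ballI differentiable_imp_continuous_within)
    (simp add: case_prod_beta')

lemma continuous_\<Phi>: "continuous_on UNIV (\<lambda>z. \<Phi> (fst z) (snd z))"
proof -
  have blk: "continuous_on UNIV (\<lambda>z :: ('n, 'd, 'm, 'N) sp_state. block (fst (fst z)) i)" for i
    by (intro linear_continuous_on_compose[OF _ linear_block] continuous_intros)
  have f: "continuous_on UNIV (\<lambda>z :: ('n, 'd, 'm, 'N) sp_state. f (block (fst (fst z)) i) (snd (snd (snd z)) $ k))"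
    for i k
  proof -
    have "continuous_on UNIV (\<lambda>z :: ('n, 'd, 'm, 'N) sp_state. (block (fst (fst z)) i, snd (snd (snd z)) $ k))"
      by (intro continuous_on_Pair blk continuous_intros)
    from continuous_on_compose2[OF continuous_on_f this] show ?thesis by simp
  qed
  have lin: "continuous_on UNIV (\<lambda>z :: ('n, 'd, 'm, 'N) sp_state. L *v snd (fst z))"
    "continuous_on UNIV (\<lambda>z :: ('n, 'd, 'm, 'N) sp_state. M *v fst (fst z))"
    by (intro linear_continuous_on_compose[OF _ matrix_vector_mul_linear] continuous_intros)+
  have "\<Phi> (fst z) (snd z) = Laug (fst (fst z)) (snd (fst z)) (fst (snd z)) (fst (snd (snd z))) (snd (snd (snd z)))"
    for z by (simp add: \<Phi>_def case_prod_beta)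
  then show ?thesis
    unfolding L_aug_def h_fun_def g_fun_def
    by (simp only:) (intro continuous_intros f lin, simp)
qed

text \<open>For fixed dual variables \<open>Laug\<close> is a function of \<open>x\<close> plus a
  function of \<open>l\<close>, without coupling; hence bounds for the two partial gradients add up
  to a joint one.\<close>

lemma exchange_x_l:
  "Laug x0 l0 \<nu> \<eta> \<xi> - Laug x l \<nu> \<eta> \<xi> =
    (Laug x0 l \<nu> \<eta> \<xi> - Laug x l \<nu> \<eta> \<xi>) + (Laug x l0 \<nu> \<eta> \<xi> - Laug x l \<nu> \<eta> \<xi>)"
  by (simp add: L_aug_def g_fun_def sum_subtractf algebra_simps)

section \<open>First-order bounds in each variable\<close>

lemma gradient_x_le:
  "(x0 - x) \<bullet> gradient (\<lambda>x'. Laug x' l \<nu> \<eta> \<xi>) x \<le> Laug x0 l \<nu> \<eta> \<xi> - Laug x l \<nu> \<eta> \<xi>"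
proof -
  define c where "c = h_fun \<epsilon> l - 1 / real CARD('N) * (\<Sum>k\<in>UNIV. l $ v k * (norm (\<xi> $ k - \<xi>hat k))\<^sup>2)
    + \<nu> \<bullet> (L *v l) + 1 / 2 * (l \<bullet> (L *v l))"
  have eq: "(\<lambda>x'. Laug x' l \<nu> \<eta> \<xi>) = (\<lambda>x'. 1 / real CARD('N) * (\<Sum>k\<in>UNIV. f (block x' (v k)) (\<xi> $ k))
      + \<eta> \<bullet> (M *v x') + 1 / 2 * (x' \<bullet> (M *v x')) + c)"
    by (simp add: fun_eq_iff L_aug_def g_fun_def c_def sum_subtractf algebra_simps)
  have "convex_on UNIV (\<lambda>x'. Laug x' l \<nu> \<eta> \<xi>)"
    unfolding eq
    by (intro convex_on_add convex_on_cmul convex_on_sum_functions convex_on_psd_quadratic[OF M_psd]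
        convex_on_compose_linear[OF f_convex linear_block] convex_on_linear[OF linear_inner_matrix])
      (simp_all add: convex_on_const)
  moreover have "(\<lambda>x'. Laug x' l \<nu> \<eta> \<xi>) differentiable (at x)"
    unfolding eq
    by (intro differentiable_add differentiable_mult differentiable_const differentiable_sum ballI
        differentiable_quadratic linear_imp_differentiable[OF linear_inner_matrix]
        differentiable_compose[of "\<lambda>x. f x _" "\<lambda>x. block x _"] linear_imp_differentiable[OF linear_block]
        differentiable_at_withinI[OF f_slice_differentiable(1)]) simp
  ultimately show ?thesis by (rule convex_on_gradient_le)
qed

lemma gradient_l_le:
  "(l0 - l) \<bullet> gradient (\<lambda>l'. Laug x l' \<nu> \<eta> \<xi>) l \<le> Laug x l0 \<nu> \<eta> \<xi> - Laug x l \<nu> \<eta> \<xi>"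
proof -
  define c where "c = 1 / real CARD('N) * (\<Sum>k\<in>UNIV. f (block x (v k)) (\<xi> $ k))
    + \<eta> \<bullet> (M *v x) + 1 / 2 * (x \<bullet> (M *v x))"
  define g where "g l' = h_fun \<epsilon> l' - 1 / real CARD('N) * (\<Sum>k\<in>UNIV. l' $ v k * (norm (\<xi> $ k - \<xi>hat k))\<^sup>2)
    + \<nu> \<bullet> (L *v l')" for l'
  have lin: "linear g"
    by (rule linearI) (simp_all add: g_def h_fun_def matrix_vector_right_distrib matrix_vector_mult_scaleR
        inner_add_right sum.distrib sum_distrib_left algebra_simps add_divide_distrib)
  have eq: "(\<lambda>l'. Laug x l' \<nu> \<eta> \<xi>) = (\<lambda>l'. g l' + 1 / 2 * (l' \<bullet> (L *v l')) + c)"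
    by (simp add: fun_eq_iff L_aug_def g_fun_def g_def c_def sum_subtractf algebra_simps)
  have "convex_on UNIV (\<lambda>l'. Laug x l' \<nu> \<eta> \<xi>)"
    unfolding eq by (intro convex_on_add convex_on_cmul convex_on_psd_quadratic[OF L_psd]
        convex_on_linear[OF lin]) (simp_all add: convex_on_const)
  moreover have "(\<lambda>l'. Laug x l' \<nu> \<eta> \<xi>) differentiable (at l)"
    unfolding eq by (intro differentiable_add differentiable_mult differentiable_const
        differentiable_quadratic linear_imp_differentiable[OF lin])
  ultimately show ?thesis by (rule convex_on_gradient_le)
qed

lemma affine_gradient_ge:
  fixes \<phi> :: "'a::euclidean_space \<Rightarrow> real"
  assumes eq: "\<phi> = (\<lambda>x. x \<bullet> a + c)"
  shows "\<phi> w - \<phi> z \<le> (w - z) \<bullet> gradient \<phi> z"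
proof (rule concave_on_gradient_ge)
  have "linear (\<lambda>x. - (x \<bullet> a))" by (rule linearI) (simp_all add: inner_add_left)
  from convex_on_add[OF convex_on_linear[OF this], of "\<lambda>x. - c"]
  have "convex_on UNIV (\<lambda>x. - (x \<bullet> a) + - c)" by (simp add: convex_on_const)
  then show "concave_on UNIV \<phi>" by (simp add: eq concave_on_def)
  show "\<phi> differentiable (at z)"
    unfolding eq differentiable_def by (auto intro!: derivative_eq_intros exI)
qed

lemma gradient_\<nu>_ge:
  "Laug x l \<nu>0 \<eta> \<xi> - Laug x l \<nu> \<eta> \<xi> \<le> (\<nu>0 - \<nu>) \<bullet> gradient (\<lambda>\<nu>'. Laug x l \<nu>' \<eta> \<xi>) \<nu>"
  by (rule affine_gradient_ge[of _ "L *v l" "Laug x l 0 \<eta> \<xi>"]) (simp add: fun_eq_iff L_aug_def)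

lemma gradient_\<eta>_ge:
  "Laug x l \<nu> \<eta>0 \<xi> - Laug x l \<nu> \<eta> \<xi> \<le> (\<eta>0 - \<eta>) \<bullet> gradient (\<lambda>\<eta>'. Laug x l \<nu> \<eta>' \<xi>) \<eta>"
  by (rule affine_gradient_ge[of _ "M *v x" "Laug x l \<nu> 0 \<xi>"]) (simp add: fun_eq_iff L_aug_def)

text \<open>The vector field differentiates in one sample at a time, and a change of
  \<open>\<xi> $ k\<close> touches only the \<open>k\<close>-th summand.\<close>

lemma Laug_update_\<xi>:
  "Laug x l \<nu> \<eta> (\<chi> j. if j = k then z else \<xi> $ j) - Laug x l \<nu> \<eta> \<xi> =
    1 / real CARD('N) * (g_fun f \<xi>hat k (block x (v k)) (l $ v k) z -
      g_fun f \<xi>hat k (block x (v k)) (l $ v k) (\<xi> $ k))"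
proof -
  let ?g = "\<lambda>j z. g_fun f \<xi>hat j (block x (v j)) (l $ v j) z"
  have "(\<Sum>j\<in>UNIV. ?g j (if j = k then z else \<xi> $ j)) - (\<Sum>j\<in>UNIV. ?g j (\<xi> $ j)) =
      (\<Sum>j\<in>UNIV. if j = k then ?g k z - ?g k (\<xi> $ k) else 0)"
    unfolding sum_subtractf[symmetric] by (rule sum.cong) auto
  also have "\<dots> = ?g k z - ?g k (\<xi> $ k)" by simp
  finally show ?thesis by (simp add: L_aug_def right_diff_distrib[symmetric] diff_divide_distrib[symmetric])
qed

text \<open>The penalty enters as minus \<open>l $ v k\<close> times a convex square, so concavity
  in \<open>\<xi> $ k\<close> rests on the sign of the multiplier; membership in
  \<open>C_set\<close> supplies it along trajectories.\<close>

lemma gradient_\<xi>_ge: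
  assumes "0 \<le> l $ v k"
  shows "1 / real CARD('N) * (g_fun f \<xi>hat k (block x (v k)) (l $ v k) z -
      g_fun f \<xi>hat k (block x (v k)) (l $ v k) (\<xi> $ k)) \<le>
    (z - \<xi> $ k) \<bullet> gradient (\<lambda>z. Laug x l \<nu> \<eta> (\<chi> j. if j = k then z else \<xi> $ j)) (\<xi> $ k)"
proof -
  let ?\<phi> = "\<lambda>z. Laug x l \<nu> \<eta> (\<chi> j. if j = k then z else \<xi> $ j)"
  define c where "c = Laug x l \<nu> \<eta> \<xi> - 1 / real CARD('N) * g_fun f \<xi>hat k (block x (v k)) (l $ v k) (\<xi> $ k)"
  have eq: "?\<phi> = (\<lambda>z. 1 / real CARD('N) * (f (block x (v k)) z - l $ v k * (norm (z - \<xi>hat k))\<^sup>2) + c)"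
  proof (rule ext)
    fix z
    show "?\<phi> z = 1 / real CARD('N) * (f (block x (v k)) z - l $ v k * (norm (z - \<xi>hat k))\<^sup>2) + c"
      using Laug_update_\<xi>[of x l \<nu> \<eta> k z \<xi>]
      by (simp add: g_fun_def c_def diff_divide_distrib)
  qed
  have minus_eq: "(\<lambda>z. - ?\<phi> z) = (\<lambda>z. 1 / real CARD('N) *
      (- f (block x (v k)) z + l $ v k * (norm (z - \<xi>hat k))\<^sup>2) + - c)"
    by (rule ext) (simp add: fun_cong[OF eq] algebra_simps)
  have "concave_on UNIV ?\<phi>"
    unfolding concave_on_def minus_eq
    using f_concave[of "block x (v k)"] assms unfolding concave_on_def
    by (intro convex_on_add convex_on_cmul convex_on_norm_square) (simp_all add: convex_on_const)
  moreover have "?\<phi> differentiable (at (\<xi> $ k))"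
    unfolding eq by (intro differentiable_add differentiable_diff differentiable_mult differentiable_const
        f_slice_differentiable(2) differentiable_norm_square)
  ultimately have "?\<phi> z - ?\<phi> (\<xi> $ k) \<le> (z - \<xi> $ k) \<bullet> gradient ?\<phi> (\<xi> $ k)"
    by (rule concave_on_gradient_ge)
  then show ?thesis
    using Laug_update_\<xi>[of x l \<nu> \<eta> k z \<xi>] Laug_update_\<xi>[of x l \<nu> \<eta> k "\<xi> $ k" \<xi>] by simp
qed

text \<open>Pointwise form of \<open>descent\<close>. The primal bound comes from the projection and
  convexity, the dual bounds from concavity; the value at the current state cancels in their
  sum.\<close>

lemma field_energy:
  assumes field: "sp_field f \<epsilon> L v \<xi>hat y d" and w: "fst w \<in> C_set"
  shows "d \<bullet> (y - w) \<le> \<Phi> (fst w) (snd y) - \<Phi> (fst y) (snd w)"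
proof -
  obtain x l \<nu> \<eta> \<xi> where y: "y = ((x, l), (\<nu>, \<eta>, \<xi>))" by (metis prod.exhaust)
  obtain dp d\<nu> d\<eta> d\<xi> where d: "d = (dp, (d\<nu>, d\<eta>, d\<xi>))" by (metis prod.exhaust)
  obtain x0 l0 \<nu>0 \<eta>0 \<xi>0 where w': "w = ((x0, l0), (\<nu>0, \<eta>0, \<xi>0))" by (metis prod.exhaust)
  have C: "(x, l) \<in> C_set" using sp_field_imp_mem_C_set[OF field] by (simp add: y)
  note F = field[unfolded y d sp_field.simps]
  have "dp \<bullet> ((x, l) - (x0, l0)) \<le>
      (x0 - x) \<bullet> gradient (\<lambda>x'. Laug x' l \<nu> \<eta> \<xi>) x + (l0 - l) \<bullet> gradient (\<lambda>l'. Laug x l' \<nu> \<eta> \<xi>) l"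
    using has_projected_value_inner_le[OF closed_C_set convex_C_set C w[unfolded w' fst_conv] F[THEN conjunct1]]
    by (simp add: inner_diff_right inner_diff_left inner_commute)
  also have "\<dots> \<le> Laug x0 l0 \<nu> \<eta> \<xi> - Laug x l \<nu> \<eta> \<xi>"
    unfolding exchange_x_l[of x0 l0] by (intro add_mono gradient_x_le gradient_l_le)
  finally have primal: "dp \<bullet> ((x, l) - (x0, l0)) \<le> Laug x0 l0 \<nu> \<eta> \<xi> - Laug x l \<nu> \<eta> \<xi>" .
  have d\<nu>: "d\<nu> \<bullet> (\<nu> - \<nu>0) \<le> Laug x l \<nu> \<eta> \<xi> - Laug x l \<nu>0 \<eta> \<xi>"
    using gradient_\<nu>_ge[of x l \<nu>0 \<eta> \<xi> \<nu>] F by (simp add: inner_diff_right inner_diff_left inner_commute)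
  have d\<eta>: "d\<eta> \<bullet> (\<eta> - \<eta>0) \<le> Laug x l \<nu> \<eta> \<xi> - Laug x l \<nu> \<eta>0 \<xi>"
    using gradient_\<eta>_ge[of x l \<nu> \<eta>0 \<xi> \<eta>] F by (simp add: inner_diff_right inner_diff_left inner_commute)
  let ?g = "\<lambda>k z. g_fun f \<xi>hat k (block x (v k)) (l $ v k) z"
  have "d\<xi> $ k \<bullet> (\<xi> $ k - \<xi>0 $ k) \<le> 1 / real CARD('N) * (?g k (\<xi> $ k) - ?g k (\<xi>0 $ k))" for k
    using gradient_\<xi>_ge[of l k x "\<xi>0 $ k" \<xi> \<nu> \<eta>] F C
    by (simp add: mem_C_set inner_diff_right inner_diff_left inner_commute diff_divide_distrib)
  then have "d\<xi> \<bullet> (\<xi> - \<xi>0) \<le> (\<Sum>k\<in>UNIV. 1 / real CARD('N) * (?g k (\<xi> $ k) - ?g k (\<xi>0 $ k)))"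
    unfolding inner_vec_def by (intro sum_mono) simp
  also have "\<dots> = 1 / real CARD('N) * ((\<Sum>k\<in>UNIV. ?g k (\<xi> $ k)) - (\<Sum>k\<in>UNIV. ?g k (\<xi>0 $ k)))"
    by (simp only: sum_distrib_left[symmetric] sum_subtractf)
  finally have d\<xi>: "d\<xi> \<bullet> (\<xi> - \<xi>0) \<le> Laug x l \<nu> \<eta> \<xi> - Laug x l \<nu> \<eta> \<xi>0"
    by (simp add: L_aug_def algebra_simps)
  \<comment> \<open>With \<open>x\<close> and \<open>l\<close> fixed, \<open>\<nu>\<close>,
    \<open>\<eta>\<close> and \<open>\<xi>\<close> enter separate summands, so the partial
    increments add up to the joint one.\<close>
  have "(Laug x l \<nu> \<eta> \<xi> - Laug x l \<nu>0 \<eta> \<xi>) + (Laug x l \<nu> \<eta> \<xi> - Laug x l \<nu> \<eta>0 \<xi>)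
      + (Laug x l \<nu> \<eta> \<xi> - Laug x l \<nu> \<eta> \<xi>0) = Laug x l \<nu> \<eta> \<xi> - Laug x l \<nu>0 \<eta>0 \<xi>0"
    by (simp add: L_aug_def)
  then show ?thesis
    using primal d\<nu> d\<eta> d\<xi> by (simp add: y d w')
qed

lemma saddle_point_consensus:
  assumes "saddle_point_over \<Phi> C_set UNIV ((x, l), (\<nu>, \<eta>, \<xi>))"
  shows "L *v l = 0" "M *v x = 0"
proof -
  have max: "Laug x l \<nu>' \<eta>' \<xi> \<le> Laug x l \<nu> \<eta> \<xi>" for \<nu>' \<eta>'
  proof -
    have "\<Phi> (x, l) (\<nu>', \<eta>', \<xi>) \<le> \<Phi> (x, l) (\<nu>, \<eta>, \<xi>)"
      using assms unfolding saddle_point_over_def fst_conv snd_conv by blast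
    then show ?thesis by simp
  qed
  \<comment> \<open>Moving \<open>\<nu>\<close> by \<open>L *v l\<close> raises \<open>Laug\<close>
    by the squared norm of \<open>L *v l\<close>, so maximality forces consensus.\<close>
  have "(L *v l) \<bullet> (L *v l) \<le> 0"
    using max[of "\<nu> + L *v l" \<eta>] by (simp add: L_aug_def inner_add_left)
  then show "L *v l = 0" by (metis inner_eq_zero_iff inner_ge_zero order_antisym)
  have "(M *v x) \<bullet> (M *v x) \<le> 0"
    using max[of \<nu> "\<eta> + M *v x"] by (simp add: L_aug_def inner_add_left)
  then show "M *v x = 0" by (metis inner_eq_zero_iff inner_ge_zero order_antisym)
qed

text \<open>At consensus the multipliers \<open>\<nu>\<close> and \<open>\<eta>\<close> drop out, so
  dual parts with the same \<open>\<xi>\<close> are interchangeable.\<close>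

lemma L_aug_consensus:
  assumes "L *v l = 0" "M *v x = 0"
  shows "Laug x l \<nu> \<eta> \<xi> = h_fun \<epsilon> l +
    1 / real CARD('N) * (\<Sum>k\<in>UNIV. g_fun f \<xi>hat k (block x (v k)) (l $ v k) (\<xi> $ k))"
  using assms by (simp add: L_aug_def)

text \<open>
  The quadratic augmentation makes \<open>\<Phi>(\<cdot>, q\<^sub>*)\<close> strictly convex transversally to the consensus
  subspace, so minimizers agree with consensus.
\<close>

lemma primal_minimizer_consensus:
  assumes s: "saddle_point_over \<Phi> C_set UNIV ((xs, ls), (\<nu>, \<eta>, \<xi>))"
    and C: "(x, l) \<in> C_set" and eq: "Laug x l \<nu> \<eta> \<xi> = Laug xs ls \<nu> \<eta> \<xi>"
  shows "L *v l = 0" "M *v x = 0"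
proof -
  let ?x = "(1/2) *\<^sub>R (x + xs)" and ?l = "(1/2) *\<^sub>R (l + ls)"
  have Cs: "(xs, ls) \<in> C_set" using s by (simp add: saddle_point_over_def)
  have "(?x, ?l) \<in> C_set" using C Cs by (simp add: mem_C_set)
  then have "\<Phi> (xs, ls) (\<nu>, \<eta>, \<xi>) \<le> \<Phi> (?x, ?l) (\<nu>, \<eta>, \<xi>)"
    using s unfolding saddle_point_over_def fst_conv snd_conv by blast
  then have min: "Laug xs ls \<nu> \<eta> \<xi> \<le> Laug ?x ?l \<nu> \<eta> \<xi>" by simp
  let ?g = "\<lambda>x l k. g_fun f \<xi>hat k (block x (v k)) (l $ v k) (\<xi> $ k)"
  have gk: "?g ?x ?l k \<le> ?g x l k / 2 + ?g xs ls k / 2" for k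
  proof -
    have "block ?x (v k) = (1 - 1/2) *\<^sub>R block x (v k) + (1/2) *\<^sub>R block xs (v k)"
      by (simp add: block_def vec_eq_iff)
    then have "f (block ?x (v k)) (\<xi> $ k) \<le> (1 - 1/2) * f (block x (v k)) (\<xi> $ k) + 1/2 * f (block xs (v k)) (\<xi> $ k)"
      using convex_onD[OF f_convex, of "1/2" "block x (v k)" "block xs (v k)"] by simp
    then show ?thesis by (simp add: g_fun_def field_simps)
  qed
  have "(\<Sum>k\<in>UNIV. ?g ?x ?l k) \<le> (\<Sum>k\<in>UNIV. ?g x l k / 2 + ?g xs ls k / 2)"
    by (intro sum_mono gk)
  then have sum: "(\<Sum>k\<in>UNIV. ?g ?x ?l k) \<le> (\<Sum>k\<in>UNIV. ?g x l k) / 2 + (\<Sum>k\<in>UNIV. ?g xs ls k) / 2"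
    by (simp add: sum.distrib sum_divide_distrib)
  have "1 / real CARD('N) * (\<Sum>k\<in>UNIV. ?g ?x ?l k) \<le>
      1 / real CARD('N) * ((\<Sum>k\<in>UNIV. ?g x l k) / 2 + (\<Sum>k\<in>UNIV. ?g xs ls k) / 2)"
    by (intro mult_left_mono sum) simp
  then have G: "1 / real CARD('N) * (\<Sum>k\<in>UNIV. ?g ?x ?l k) \<le>
      (1 / real CARD('N) * (\<Sum>k\<in>UNIV. ?g x l k)) / 2 + (1 / real CARD('N) * (\<Sum>k\<in>UNIV. ?g xs ls k)) / 2"
    by (simp add: add_divide_distrib)
  have H: "h_fun \<epsilon> ?l = h_fun \<epsilon> l / 2 + h_fun \<epsilon> ls / 2"
    by (simp add: h_fun_def inner_add_right field_simps)
  have lin: "a \<bullet> (B *v ((1/2) *\<^sub>R (b + c))) = (a \<bullet> (B *v b)) / 2 + (a \<bullet> (B *v c)) / 2"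
    for a b c and B :: "real^'z^'z"
    by (simp add: matrix_vector_mult_scaleR matrix_vector_right_distrib inner_add_right add_divide_distrib)
  \<comment> \<open>The factor 1/2 before the forms and the 1/4 of the parallelogram law give 1/8.
    The midpoint of two minimizers would undercut the minimum by \<open>(?q + ?r) / 8\<close>, so
    both forms vanish.\<close>
  let ?q = "(x - xs) \<bullet> (M *v (x - xs))" and ?r = "(l - ls) \<bullet> (L *v (l - ls))"
  have "Laug ?x ?l \<nu> \<eta> \<xi> \<le> Laug x l \<nu> \<eta> \<xi> / 2 + Laug xs ls \<nu> \<eta> \<xi> / 2 - (?q + ?r) / 8"
    using G unfolding L_aug_def H lin[of \<nu>] lin[of \<eta>]
      psd_quadratic_midpoint[OF L_symmetric] psd_quadratic_midpoint[OF M_symmetric] by argo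
  then have "?q + ?r \<le> 0" using min eq by argo
  then have "?q = 0" "?r = 0" using M_psd[of "x - xs"] L_psd[of "l - ls"] by linarith+
  then have "M *v (x - xs) = 0" "L *v (l - ls) = 0"
    using psd_kernel[OF M_symmetric M_psd] psd_kernel[OF L_symmetric L_psd] by blast+
  then show "L *v l = 0" "M *v x = 0"
    using saddle_point_consensus[OF s] by (simp_all add: matrix_vector_mult_diff_distrib)
qed

text \<open>Positive multipliers \<open>\<lambda>\<^sub>*\<close> make \<open>\<Phi>(p\<^sub>*, \<cdot>)\<close> strictly concave in the \<open>\<xi>\<close> components.\<close>

lemma dual_maximizer_unique:
  assumes s: "saddle_point_over \<Phi> C_set UNIV ((x, l), (\<nu>s, \<eta>s, \<xi>s))"
    and pos: "\<And>i. 0 < l $ i" and eq: "Laug x l \<nu> \<eta> \<xi> = Laug x l \<nu>s \<eta>s \<xi>s"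
  shows "\<xi> = \<xi>s"
proof -
  let ?m = "(1/2) *\<^sub>R (\<xi> + \<xi>s)"
  let ?g = "\<lambda>\<xi> k. g_fun f \<xi>hat k (block x (v k)) (l $ v k) (\<xi> $ k)"
  have "\<Phi> (x, l) (\<nu>s, \<eta>s, ?m) \<le> \<Phi> (x, l) (\<nu>s, \<eta>s, \<xi>s)"
    using s unfolding saddle_point_over_def fst_conv snd_conv by blast
  \<comment> \<open>\<open>(x, l)\<close> is in consensus, so only the sample terms remain in the
    comparison.\<close>
  then have max: "(\<Sum>k\<in>UNIV. ?g ?m k) \<le> (\<Sum>k\<in>UNIV. ?g \<xi>s k)"
    by (simp add: L_aug_consensus saddle_point_consensus[OF s] divide_le_cancel)
  have same: "(\<Sum>k\<in>UNIV. ?g \<xi> k) = (\<Sum>k\<in>UNIV. ?g \<xi>s k)"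
    using eq by (simp add: L_aug_consensus saddle_point_consensus[OF s])
  \<comment> \<open>The margin of strict concavity at the midpoint: a quarter of the squared
    distance, weighted by the positive multiplier.\<close>
  let ?e = "\<lambda>k. l $ v k * (norm (\<xi> $ k - \<xi>s $ k))\<^sup>2 / 4"
  have gk: "?g \<xi> k / 2 + ?g \<xi>s k / 2 + ?e k \<le> ?g ?m k" for k
  proof -
    have m: "?m $ k = (1/2) *\<^sub>R (\<xi> $ k + \<xi>s $ k)" by simp
    have m': "?m $ k = (1 - 1/2) *\<^sub>R \<xi> $ k + (1/2) *\<^sub>R \<xi>s $ k" by (simp add: scaleR_add_right)
    have "- f (block x (v k)) (?m $ k) \<le> (1 - 1/2) * - f (block x (v k)) (\<xi> $ k) + 1/2 * - f (block x (v k)) (\<xi>s $ k)"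
      unfolding m' by (rule convex_onD[OF f_concave[unfolded concave_on_def]]) auto
    moreover have "l $ v k * (norm (?m $ k - \<xi>hat k))\<^sup>2 =
        l $ v k * (norm (\<xi> $ k - \<xi>hat k))\<^sup>2 / 2 + l $ v k * (norm (\<xi>s $ k - \<xi>hat k))\<^sup>2 / 2 - ?e k"
      unfolding m norm_square_midpoint by (simp add: algebra_simps)
    ultimately show ?thesis unfolding g_fun_def by argo
  qed
  have "(\<Sum>k\<in>UNIV. ?g \<xi> k / 2 + ?g \<xi>s k / 2 + ?e k) \<le> (\<Sum>k\<in>UNIV. ?g ?m k)"
    by (intro sum_mono gk)
  then have "(\<Sum>k\<in>UNIV. ?g \<xi> k) / 2 + (\<Sum>k\<in>UNIV. ?g \<xi>s k) / 2 + (\<Sum>k\<in>UNIV. ?e k) \<le> (\<Sum>k\<in>UNIV. ?g ?m k)"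
    by (simp only: sum.distrib sum_divide_distrib)
  then have "(\<Sum>k\<in>UNIV. ?e k) \<le> 0" using max same by linarith
  moreover have nonneg: "0 \<le> ?e k" for k using pos[of "v k"] by simp
  ultimately have "(\<Sum>k\<in>UNIV. ?e k) = 0"
    by (intro antisym sum_nonneg) auto
  then have e0: "?e k = 0" for k
    using sum_nonneg_eq_0_iff[of UNIV ?e] nonneg by simp
  have "\<xi> $ k = \<xi>s $ k" for k
    using e0[of k] pos[of "v k"] by simp
  then show ?thesis by (simp add: vec_eq_iff)
qed

text \<open>Only the primal part of \<open>z\<close> and the dual part of \<open>w\<close> enter.
  The former is in consensus and the latter has the \<open>\<xi>\<close> of \<open>s\<close>, so the
  dual part of \<open>w\<close> may be replaced by that of \<open>s\<close>, against which
  \<open>z\<close> attains the saddle value.\<close>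

lemma zero_dissipation:
  assumes s: "saddle_point_over \<Phi> C_set UNIV s" and pos: "\<And>i. 0 < snd (fst s) $ i"
    and z: "fst z \<in> C_set" "\<Phi> (fst s) (snd z) = \<Phi> (fst z) (snd s)"
    and w: "fst w \<in> C_set" "\<Phi> (fst s) (snd w) = \<Phi> (fst w) (snd s)"
  shows "\<Phi> (fst z) (snd w) = \<Phi> (fst s) (snd s)"
proof -
  have eqs: "\<Phi> (fst s) (snd u) = \<Phi> (fst s) (snd s)" "\<Phi> (fst u) (snd s) = \<Phi> (fst s) (snd s)"
    if "fst u \<in> C_set" "\<Phi> (fst s) (snd u) = \<Phi> (fst u) (snd s)" for u
  proof -
    have "\<Phi> (fst s) (snd u) \<le> \<Phi> (fst s) (snd s)" "\<Phi> (fst s) (snd s) \<le> \<Phi> (fst u) (snd s)"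
      using s that(1) unfolding saddle_point_over_def by blast+
    then show "\<Phi> (fst s) (snd u) = \<Phi> (fst s) (snd s)" "\<Phi> (fst u) (snd s) = \<Phi> (fst s) (snd s)"
      using that(2) by linarith+
  qed
  obtain xs ls \<nu>s \<eta>s \<xi>s where s': "s = ((xs, ls), (\<nu>s, \<eta>s, \<xi>s))" by (metis prod.exhaust)
  obtain x l q where z': "z = ((x, l), q)" by (metis prod.exhaust)
  obtain p \<nu> \<eta> \<xi> where w': "w = (p, (\<nu>, \<eta>, \<xi>))" by (metis prod.exhaust)
  note s = s[unfolded s']
  have val: "Laug x l \<nu>s \<eta>s \<xi>s = Laug xs ls \<nu>s \<eta>s \<xi>s"
    using eqs(2)[OF z] by (simp add: s' z')
  have "(x, l) \<in> C_set" using z(1) by (simp add: z')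
  note consensus = primal_minimizer_consensus[OF s this val]
  have dual: "Laug xs ls \<nu> \<eta> \<xi> = Laug xs ls \<nu>s \<eta>s \<xi>s"
    using eqs(1)[OF w] by (simp add: s' w')
  have "\<xi> = \<xi>s"
    by (rule dual_maximizer_unique[OF s _ dual]) (use pos in \<open>simp add: s'\<close>)
  then have "Laug x l \<nu> \<eta> \<xi> = Laug x l \<nu>s \<eta>s \<xi>s"
    by (simp add: L_aug_consensus[OF consensus])
  then show ?thesis using val by (simp add: s' z' w')
qed

text \<open>Weak duality. Changing one sample at a time shows that each \<open>\<xi> $ k\<close>
  attains the inner maximum, so \<open>F_objective\<close> equals \<open>Laug\<close> at the saddle
  point. At any feasible point the inner suprema, possibly infinite, dominate the value at this
  \<open>\<xi>\<close>, where the primal saddle inequality applies.\<close>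

lemma saddle_point_optimizer:
  assumes s: "saddle_point_over \<Phi> C_set UNIV s"
  shows "D_optimizer f \<epsilon> L v \<xi>hat (fst s)"
proof -
  obtain x l \<nu> \<eta> \<xi> where s': "s = ((x, l), (\<nu>, \<eta>, \<xi>))" by (metis prod.exhaust)
  note s = s[unfolded s']
  note consensus = saddle_point_consensus[OF s]
  have "(x, l) \<in> C_set" using s by (simp add: saddle_point_over_def)
  then have feasible: "(x, l) \<in> D_feasible L"
    using consensus by (simp add: D_feasible_def mem_C_set)
  have sup: "(SUP z. ereal (g_fun f \<xi>hat k (block x (v k)) (l $ v k) z)) =
      ereal (g_fun f \<xi>hat k (block x (v k)) (l $ v k) (\<xi> $ k))" for k
  proof (rule antisym)
    show "(SUP z. ereal (g_fun f \<xi>hat k (block x (v k)) (l $ v k) z)) \<le>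
        ereal (g_fun f \<xi>hat k (block x (v k)) (l $ v k) (\<xi> $ k))"
    proof (rule SUP_least)
      fix z
      let ?\<xi> = "\<chi> j. if j = k then z else \<xi> $ j"
      have "\<Phi> (x, l) (\<nu>, \<eta>, ?\<xi>) \<le> \<Phi> (x, l) (\<nu>, \<eta>, \<xi>)"
        using s unfolding saddle_point_over_def fst_conv snd_conv by blast
      then have "1 / real CARD('N) * (g_fun f \<xi>hat k (block x (v k)) (l $ v k) z -
          g_fun f \<xi>hat k (block x (v k)) (l $ v k) (\<xi> $ k)) \<le> 0"
        using Laug_update_\<xi>[of x l \<nu> \<eta> k z \<xi>] by simp
      then show "ereal (g_fun f \<xi>hat k (block x (v k)) (l $ v k) z) \<le>
          ereal (g_fun f \<xi>hat k (block x (v k)) (l $ v k) (\<xi> $ k))"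
        by (simp add: divide_le_0_iff)
    qed
  qed (rule SUP_upper, simp)
  have F: "F_objective f \<epsilon> v \<xi>hat x l = ereal (Laug x l \<nu> \<eta> \<xi>)"
    by (simp add: F_objective_def sup L_aug_consensus[OF consensus])
  have "F_objective f \<epsilon> v \<xi>hat x l \<le> F_objective f \<epsilon> v \<xi>hat x' l'" if p: "(x', l') \<in> D_feasible L" for x' l'
  proof -
    have p': "(x', l') \<in> C_set" "L *v l' = 0" "M *v x' = 0"
      using p by (simp_all add: D_feasible_def mem_C_set)
    have "\<Phi> (x, l) (\<nu>, \<eta>, \<xi>) \<le> \<Phi> (x', l') (\<nu>, \<eta>, \<xi>)"
      using s p'(1) unfolding saddle_point_over_def fst_conv snd_conv by blast
    then have "ereal (Laug x l \<nu> \<eta> \<xi>) \<le> ereal (Laug x' l' \<nu> \<eta> \<xi>)" by simp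
    also have "\<dots> = ereal (h_fun \<epsilon> l') + ereal (1 / real CARD('N)) *
        (\<Sum>k\<in>UNIV. ereal (g_fun f \<xi>hat k (block x' (v k)) (l' $ v k) (\<xi> $ k)))"
      by (simp add: L_aug_consensus[OF p'(2,3)])
    also have "\<dots> \<le> F_objective f \<epsilon> v \<xi>hat x' l'"
      unfolding F_objective_def
      by (intro add_left_mono ereal_mult_left_mono sum_mono SUP_upper) simp_all
    finally show ?thesis unfolding F .
  qed
  then show ?thesis
    using feasible by (auto simp: D_optimizer_def s')
qed

end

theorem mainTheorem7:
  fixes f :: "real^'d \<Rightarrow> real^'m \<Rightarrow> real"
    and \<epsilon> :: real
    and E :: "('n::finite \<times> 'n) set" and A L :: "real^'n^'n"
    and v :: "'N::finite \<Rightarrow> 'n" and \<xi>hat :: "'N \<Rightarrow> real^'m"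
    and \<gamma> :: "real \<Rightarrow> ('n, 'd, 'm, 'N) sp_state"
  assumes "\<epsilon> \<ge> 0"
    and graph: "connected_weighted_graph E A"
    and L_def: "L = laplacian A"
    and each_agent_has_sample: "surj v"
    and f_C1: "continuously_differentiable (\<lambda>(x, \<xi>). f x \<xi>)"
    and f_recession: "closure {\<xi>. \<not> recession_direction (\<lambda>x. f x \<xi>) 1 \<and>
                                  \<not> recession_direction (\<lambda>x. f x \<xi>) (- 1)} = UNIV"
    and P_interior: "interior {(l, x). 0 \<le> l \<and> \<bar>P_objective f \<epsilon> \<xi>hat l x\<bar> \<noteq> \<infinity>} \<noteq> {}"
    and P_optimizer: "\<exists>l\<ge>0. \<exists>x. \<bar>P_objective f \<epsilon> \<xi>hat l x\<bar> \<noteq> \<infinity> \<and>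
                        (\<forall>l'\<ge>0. \<forall>x'. P_objective f \<epsilon> \<xi>hat l x \<le> P_objective f \<epsilon> \<xi>hat l' x')"
    and f_convex: "\<And>\<xi>. convex_on UNIV (\<lambda>x. f x \<xi>)"
    and f_concave: "\<And>x. concave_on UNIV (\<lambda>\<xi>. f x \<xi>)"
    and saddle_exists: "\<exists>x l \<nu> \<eta> \<xi>. L_aug_saddle_point f \<epsilon> L v \<xi>hat ((x, l), (\<nu>, \<eta>, \<xi>)) \<and>
                                     (\<forall>i. 0 < l $ i)"
    and trajectory: "caratheodory_solution (sp_field f \<epsilon> L v \<xi>hat) \<gamma>"
    and start: "\<gamma> 0 \<in> C_set \<times> UNIV"
  shows "(\<forall>t\<ge>0. \<gamma> t \<in> C_set \<times> UNIV) \<and>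
         (\<exists>s. L_aug_saddle_point f \<epsilon> L v \<xi>hat s \<and> (\<gamma> \<longlongrightarrow> s) at_top) \<and>
         (\<exists>p. D_optimizer f \<epsilon> L v \<xi>hat p \<and> ((\<lambda>t. fst (\<gamma> t)) \<longlongrightarrow> p) at_top)"
proof -
  have A: "transpose A = A" "\<And>i j. 0 \<le> A $ i $ j"
    using graph unfolding connected_weighted_graph_def by (auto split: if_splits) (metis less_eq_real_def)
  obtain G where "\<And>z. GDERIV (\<lambda>(x, \<xi>). f x \<xi>) z :> G z"
    using f_C1 unfolding continuously_differentiable_def by blast
  then have "(\<lambda>(x, \<xi>). f x \<xi>) differentiable (at z)" for z
    unfolding gderiv_def differentiable_def by blast
  then interpret augmented_lagrangian f \<epsilon> L v \<xi>hat
    by unfold_locales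
      (simp_all add: L_def laplacian_symmetric[OF A(1)] laplacian_psd[OF A] f_convex f_concave)
  have invariant: "\<gamma> t \<in> C_set \<times> UNIV" if "0 \<le> t" for t
    by (rule caratheodory_solution_mem_closed[OF trajectory _ start sp_field_imp_mem_C_set that])
      (intro closed_Times closed_C_set closed_UNIV)
  interpret saddle_flow \<Phi> C_set \<gamma>
  proof
    show "fst (\<gamma> t) \<in> C_set" if "0 \<le> t" for t
      using invariant[OF that] by auto
    show "(norm (\<gamma> b - w))\<^sup>2 / 2 - (norm (\<gamma> a - w))\<^sup>2 / 2 \<le> K * (b - a)"
      if "fst w \<in> C_set" "0 \<le> a" "a \<le> b"
        "\<And>t. \<lbrakk>a < t; t < b\<rbrakk> \<Longrightarrow> \<Phi> (fst w) (snd (\<gamma> t)) - \<Phi> (fst (\<gamma> t)) (snd w) \<le> K"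
      for w a b K
    proof (rule caratheodory_solution_energy[OF trajectory that(2,3)])
      fix t d
      assume "a < t" "t < b" "sp_field f \<epsilon> L v \<xi>hat (\<gamma> t) d"
      then show "d \<bullet> (\<gamma> t - w) \<le> K"
        using field_energy[OF _ that(1)] that(4) by (meson order_trans)
    qed
  qed (rule continuous_\<Phi> closed_C_set)+
  obtain s where s: "saddle_point_over \<Phi> C_set UNIV s" and pos: "\<And>i. 0 < snd (fst s) $ i"
    using saddle_exists unfolding saddle_point_iff by auto
  \<comment> \<open>Applied in both orders, \<open>zero_dissipation\<close> gives both terms of
    \<open>gap z w\<close> the saddle value, so their difference is zero.\<close>
  have "gap z w \<le> 0"
    if "fst z \<in> C_set" "fst w \<in> C_set" "gap s z = 0" "gap s w = 0" for z w
    using zero_dissipation[OF s pos, of z w] zero_dissipation[OF s pos, of w z] that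
    by (simp add: gap_def)
  from converges_to_saddle[OF s this]
  obtain z where z: "saddle_point_over \<Phi> C_set UNIV z" "(\<gamma> \<longlongrightarrow> z) at_top" by blast
  show ?thesis
    using invariant z saddle_point_iff saddle_point_optimizer[OF z(1)] tendsto_fst[OF z(2)] by blast
qed

end
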